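(* Let $d\geq2$ be an integer and let $N(z)=\#\{j:\lambda_j\le z\}$ be the counting function of the Laplacian eigenvalues $\lambda_j$ (counted with multiplicity) on $\mathbb{S}^d$. For $z\ge0$ let $w\ge0$ be defined by $w(w+d-1)=z$. As $z\to\infty$, $$ \frac{N(z)}{L^{class}_{0,d}|\mathbb{S}^d|z^{\frac d2}}=1-\frac{L^{class}_{0,d-1}}{L^{class}_{0,d}}\frac{|\partial\mathbb{S}^d_+|}{|\mathbb{S}^d|}\psi(w)z^{-\frac12}+\frac{d(d-1)(12\psi^2(w)+2d-1)}{24}z^{-1}+O(z^{-\frac32}). $$
   Context: $\mathbb{S}^d$ is the round unit sphere in $\mathbb{R}^{d+1}$, $\mathbb{S}^d_+=\mathbb{S}^d\cap\{x_{d+1}>0\}$ the hemisphere, and $|\partial\mathbb{S}^d_+|=|\mathbb{S}^{d-1}|$ the $(d-1)$-dimensional measure of its boundary. The distinct eigenvalues (energy levels) of $-\Delta$ on $\mathbb{S}^d$ are $\lambda_{(l)}=l(l+d-1)$, $l\in\mathbb{N}=\{0,1,2,\dots\}$, with multiplicity $m_{l,d}=\binom{d+l}{l}-\binom{d+l-2}{l-2}$ (a binomial coefficient with negative lower entry being $0$). The semiclassical constant is $L_{\gamma,d}^{class}=(4\pi)^{-d/2}\frac{\Gamma(\gamma+1)}{\Gamma(\gamma+1+d/2)}$, so $L_{0,d}^{class}|\mathbb{S}^d|=\frac{2}{d!}$. The fluctuation function is $\psi(\eta)=\eta-\lfloor\eta\rfloor-\frac12$, $\eta\geq0$; $\psi^2(w)=(\psi(w))^2$.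 *)

theory Defs
  imports "HOL-Analysis.Analysis" "HOL-Library.Function_Algebras"
begin

section \<open>The Laplacian on the unit sphere of a Euclidean space\<close>

definition dir_deriv :: "'a::euclidean_space \<Rightarrow> ('a \<Rightarrow> real) \<Rightarrow> 'a \<Rightarrow> real" where
  "dir_deriv v F x = frechet_derivative F (at x) v"

text \<open>\<open>frechet_derivative\<close> is total, so differentiability is demanded separately; \<open>U\<close> is meant
  to be open.\<close>

definition C2_on :: "'a::euclidean_space set \<Rightarrow> ('a \<Rightarrow> real) \<Rightarrow> bool" where
  "C2_on U F \<longleftrightarrow>
     (\<forall>x\<in>U. F differentiable (at x)) \<and>
     (\<forall>u. \<forall>x\<in>U. dir_deriv u F differentiable (at x)) \<and>
     (\<forall>u v. continuous_on U (dir_deriv v (dir_deriv u F)))"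

definition laplacian :: "('a::euclidean_space \<Rightarrow> real) \<Rightarrow> 'a \<Rightarrow> real" where
  "laplacian F x = (\<Sum>b\<in>Basis. dir_deriv b (dir_deriv b F) x)"

text \<open>The extension \<open>x \<mapsto> f (x / \<parallel>x\<parallel>)\<close> is homogeneous of degree 0 off the origin and depends only on
  the values of \<open>f\<close> on the unit sphere. A function on the sphere is \<open>C\<^sup>2\<close> iff this extension is
  \<open>C\<^sup>2\<close> off the origin, and the Euclidean Laplacian of the extension, restricted to the sphere, is
  the Laplace--Beltrami operator of the round metric.\<close>

definition radial_ext :: "('a::euclidean_space \<Rightarrow> real) \<Rightarrow> 'a \<Rightarrow> real" where
  "radial_ext f x = f (sgn x)"

definition sphere_laplacian :: "('a::euclidean_space \<Rightarrow> real) \<Rightarrow> 'a \<Rightarrow> real" where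
  "sphere_laplacian f x = laplacian (radial_ext f) x"

text \<open>Functions on the sphere are represented by functions on the ambient space vanishing off the
  sphere, so that they form a vector space under the pointwise operations. As \<open>-\<Delta>\<close> is a real
  operator, real and complex multiplicities agree, and by elliptic regularity it does not matter
  whether eigenfunctions are taken \<open>C\<^sup>2\<close>, smooth, or in the operator domain in \<open>L\<^sup>2\<close>.\<close>

definition eigenspace :: "real \<Rightarrow> ('a::euclidean_space \<Rightarrow> real) set" where
  "eigenspace \<mu> =
     {f. (\<forall>x. x \<notin> sphere 0 1 \<longrightarrow> f x = 0) \<and>
         C2_on (- {0}) (radial_ext f) \<and>
         (\<forall>x\<in>sphere 0 1. - sphere_laplacian f x = \<mu> * f x)}"

definition multiplicity_of :: "'a::euclidean_space itself \<Rightarrow> real \<Rightarrow> nat" where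
  "multiplicity_of _ \<mu> =
     vector_space.dim (\<lambda>(c::real) f x. c * f x) (eigenspace \<mu> :: ('a \<Rightarrow> real) set)"

text \<open>Counting with multiplicity: each eigenvalue \<open>\<mu>\<close> contributes one index \<open>(\<mu>, j)\<close> for every
  \<open>j\<close> below its multiplicity; a number that is not an eigenvalue has multiplicity 0.\<close>

definition eigenvalue_count :: "'a::euclidean_space itself \<Rightarrow> real \<Rightarrow> nat" where
  "eigenvalue_count T z = card {(\<mu>, j). \<mu> \<le> z \<and> j < multiplicity_of T \<mu>}"


section \<open>Surface measure, the semiclassical constant and the fluctuation function\<close>

text \<open>Surface measure on the unit sphere of an \<open>n\<close>-dimensional space: \<open>n\<close> times the Lebesgue measure
  of the cone over \<open>A\<close> (integration in polar coordinates).\<close>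

definition sphere_measure :: "'a::euclidean_space set \<Rightarrow> real" where
  "sphere_measure A =
     real DIM('a) * measure lebesgue {t *\<^sub>R x | t x. 0 \<le> t \<and> t \<le> 1 \<and> x \<in> A}"

text \<open>With \<open>\<real>\<^sup>d \<times> \<real>\<close> as the ambient space, the boundary of the open hemisphere is
  \<open>{(x, 0) | x. \<parallel>x\<parallel> = 1}\<close>; its \<open>(d - 1)\<close>-dimensional measure is the volume of the unit
  sphere of \<open>\<real>\<^sup>d\<close>.\<close>

definition sphere_volume :: "'a::euclidean_space itself \<Rightarrow> real" where
  "sphere_volume _ = sphere_measure (sphere (0::'a) 1)"

definition L_class :: "real \<Rightarrow> nat \<Rightarrow> real" where
  "L_class \<gamma> d =
     (4 * pi) powr (- (real d / 2)) * Gamma (\<gamma> + 1) / Gamma (\<gamma> + 1 + real d / 2)"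

definition psi :: "real \<Rightarrow> real" where
  "psi \<eta> = \<eta> - of_int \<lfloor>\<eta>\<rfloor> - 1 / 2"

end

theory Submission
  imports Defs "HOL-Library.Landau_Symbols"
begin

text \<open>Write \<open>n = d + 1\<close> for the dimension of the ambient space. The proof determines the whole spectrum of
the Laplacian on the unit sphere, sums the multiplicities to a closed form, and expands it.

Polynomials produce the spectrum. If \<open>p\<close> is a homogeneous polynomial of degree \<open>k\<close>, the Laplacian of
the sphere maps its restriction to the restriction of \<open>\<Delta>p - k(k + n - 2) p\<close>
(\<open>sphere_laplacian_on_sphere\<close>). Since the Laplacian is symmetric for the inner product of the
sphere (\<open>sphere_inner_laplacian_symmetric\<close>), an eigenfunction \<open>f\<close> with eigenvalue \<open>\<mu>\<close> satisfies
\<open>(k(k + n - 2) - \<mu>) \<langle>f, p\<rangle> = \<langle>f, \<Delta>p\<rangle>\<close>, where \<open>\<Delta>p\<close> has degree \<open>k - 2\<close>. By induction on the degree,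
\<open>f\<close> is orthogonal to every homogeneous polynomial as soon as it is orthogonal to those of a degree \<open>k\<close>
with \<open>k(k + n - 2) = \<mu>\<close>; and a continuous function orthogonal to all polynomials vanishes, by the
Stone--Weierstrass theorem. So no number \<open>\<mu>\<close> other than the \<open>k(k + n - 2)\<close> is an eigenvalue.

For \<open>\<mu> = k(k + n - 2)\<close> the same argument bounds the multiplicity from above: on the sphere one square
\<open>(x \<bullet> b)\<^sup>2\<close> can be eliminated, so \<open>f\<close> is determined by its inner products with the monomials of degree
\<open>k\<close> whose exponent at \<open>b\<close> is 0 or 1. Their number is the number of all monomials of degree \<open>k\<close> minus
the number of those of degree \<open>k - 2\<close>. The restrictions of the harmonic polynomials of degree \<open>k\<close> are
eigenfunctions, and they span a space of at least this dimension, because they form the kernel of a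
linear map \<open>\<Delta>\<close> from polynomials of degree \<open>k\<close> to polynomials of degree \<open>k - 2\<close>. Hence equality
(\<open>multiplicity_eigenvalue\<close>).

The multiplicities telescope, so with \<open>L = \<lfloor>w\<rfloor>\<close> the counting function is
\<open>binomial (L + d) d + binomial (L - 1 + d) d\<close>, that is, \<open>2/d!\<close> times the product of \<open>L + d/2\<close> and the
numbers \<open>L + j\<close> with \<open>1 \<le> j < d\<close>. Put \<open>u = w + (d - 1)/2\<close>, so that \<open>u\<^sup>2 = z + (d - 1)\<^sup>2/4\<close> and
\<open>L + d/2 = u - \<psi>(w)\<close>. After division by \<open>\<surd>z\<close>, each of the \<open>d\<close> factors is
\<open>1 + (c\<^sub>j - \<psi>(w)) z\<^sup>-\<^sup>1\<^sup>/\<^sup>2 + (d - 1)\<^sup>2/8 z\<^sup>-\<^sup>1 + O(z\<^sup>-\<^sup>3\<^sup>/\<^sup>2)\<close>, with shifts \<open>c\<^sub>j\<close> that sum to 0; multiplying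
out gives the expansion (\<open>prod_second_order_expansion\<close>).\<close>

section \<open>Directional derivatives and functions homogeneous of degree 0\<close>

lemma dir_deriv_eqI: "(F has_derivative D) (at x) \<Longrightarrow> dir_deriv v F x = D v"
  unfolding dir_deriv_def by (simp add: frechet_derivative_at[symmetric])

lemma dir_deriv_works:
  "F differentiable (at x) \<Longrightarrow> (F has_derivative (\<lambda>v. dir_deriv v F x)) (at x)"
  unfolding dir_deriv_def by (simp add: frechet_derivative_works[symmetric])

lemma has_derivative_cong_open:
  assumes "(G has_derivative D) (at x)" "open U" "x \<in> U" "\<And>y. y \<in> U \<Longrightarrow> F y = G y"
  shows "(F has_derivative D) (at x)"
  using has_derivative_transform_within_open[OF assms(1-3), of F] assms(4) by simp

lemma open_minus_origin: "open (- {0::'a::euclidean_space})" by auto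

lemma radial_ext_scale: "c > 0 \<Longrightarrow> radial_ext f (c *\<^sub>R x) = radial_ext f x"
  by (simp add: radial_ext_def sgn_scaleR)

lemma dir_deriv_rescale:
  fixes F :: "'a::euclidean_space \<Rightarrow> real"
  assumes "F differentiable (at (c *\<^sub>R x))" "c > 0" "x \<noteq> 0"
    "\<And>y. y \<noteq> 0 \<Longrightarrow> F y = a * F (c *\<^sub>R y)"
  shows "dir_deriv v F x = a * c * dir_deriv v F (c *\<^sub>R x)"
proof -
  have "((\<lambda>y. c *\<^sub>R y) has_derivative (\<lambda>v. c *\<^sub>R v)) (at x)"
    by (rule has_derivative_scaleR_right[OF has_derivative_ident])
  from has_derivative_mult_right[OF has_derivative_compose[OF this dir_deriv_works[OF assms(1)]]]
  have "((\<lambda>y. a * F (c *\<^sub>R y)) has_derivative (\<lambda>v. a * dir_deriv (c *\<^sub>R v) F (c *\<^sub>R x))) (at x)" .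
  then have "(F has_derivative (\<lambda>v. a * dir_deriv (c *\<^sub>R v) F (c *\<^sub>R x))) (at x)"
    by (rule has_derivative_cong_open[OF _ open_minus_origin]) (use assms(3) in simp, rule assms(4), simp)
  then have "dir_deriv v F x = a * dir_deriv (c *\<^sub>R v) F (c *\<^sub>R x)" by (rule dir_deriv_eqI)
  moreover have "dir_deriv (c *\<^sub>R v) F (c *\<^sub>R x) = c * dir_deriv v F (c *\<^sub>R x)"
    using linear_scale[OF has_derivative_linear[OF dir_deriv_works[OF assms(1)]], of c v] by simp
  ultimately show ?thesis by simp
qed

text \<open>The Laplacian of a function homogeneous of degree 0 is homogeneous of degree \<open>- 2\<close>: each of the
two differentiations lowers the degree by 1.\<close>

lemma laplacian_radial_ext:
  fixes f :: "'a::euclidean_space \<Rightarrow> real"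
  assumes "C2_on (- {0}) (radial_ext f)" "x \<noteq> 0"
  shows "laplacian (radial_ext f) x = sphere_laplacian f (sgn x) / (x \<bullet> x)"
proof -
  define c where "c = inverse (norm x)"
  have c: "c > 0" using assms(2) by (simp add: c_def)
  let ?F = "radial_ext f"
  have diff: "?F differentiable (at y)" "dir_deriv u ?F differentiable (at y)" if "y \<noteq> 0" for u y
    using assms(1) that by (simp_all add: C2_on_def)
  have d1: "dir_deriv u ?F y = c * dir_deriv u ?F (c *\<^sub>R y)" if "y \<noteq> 0" for u y
  proof -
    have "?F z = 1 * ?F (c *\<^sub>R z)" for z using c by (simp add: radial_ext_scale)
    from dir_deriv_rescale[OF diff(1) c that this] show ?thesis using that c by simp
  qed
  have "dir_deriv b (dir_deriv b ?F) x = c * c * dir_deriv b (dir_deriv b ?F) (c *\<^sub>R x)" for b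
    by (rule dir_deriv_rescale[OF diff(2) c assms(2) d1]) (use assms(2) c in auto)
  then have "laplacian ?F x = c * c * laplacian ?F (sgn x)"
    unfolding laplacian_def by (simp add: sum_distrib_left sgn_div_norm c_def divide_inverse)
  then show ?thesis
    by (simp add: sphere_laplacian_def c_def dot_square_norm power2_eq_square field_simps)
qed

text \<open>The radial extension is constant on every ray from the origin.\<close>

lemma dir_deriv_radial_ext_radial:
  fixes f :: "'a::euclidean_space \<Rightarrow> real"
  assumes "radial_ext f differentiable (at x)" "x \<noteq> 0"
  shows "dir_deriv x (radial_ext f) x = 0"
proof -
  let ?F = "radial_ext f"
  have "((\<lambda>t::real. ?F (t *\<^sub>R x)) has_derivative (\<lambda>s. dir_deriv (s *\<^sub>R x) ?F (1 *\<^sub>R x))) (at 1)"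
    by (rule has_derivative_compose[where f="\<lambda>t. t *\<^sub>R x" and s=UNIV, OF _ dir_deriv_works])
       (use assms in \<open>auto intro!: derivative_eq_intros\<close>)
  moreover have "((\<lambda>t::real. ?F (t *\<^sub>R x)) has_derivative (\<lambda>s. 0)) (at 1)"
    by (rule has_derivative_cong_open[of "\<lambda>t. ?F x" _ _ "{0<..}"]) (auto simp: radial_ext_scale)
  ultimately have "(\<lambda>s::real. dir_deriv (s *\<^sub>R x) ?F (1 *\<^sub>R x)) = (\<lambda>s. 0)"
    by (rule has_derivative_unique)
  from fun_cong[OF this, of 1] show ?thesis by simp
qed

lemma sum_coord_dir_deriv:
  fixes F :: "'a::euclidean_space \<Rightarrow> real"
  assumes "F differentiable (at x)"
  shows "(\<Sum>b\<in>Basis. (v \<bullet> b) * dir_deriv b F x) = dir_deriv v F x"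
proof -
  have lin: "linear (\<lambda>v. dir_deriv v F x)" by (rule has_derivative_linear[OF dir_deriv_works[OF assms]])
  have "dir_deriv v F x = dir_deriv (\<Sum>b\<in>Basis. (v \<bullet> b) *\<^sub>R b) F x" by (simp add: euclidean_representation)
  also have "\<dots> = (\<Sum>b\<in>Basis. (v \<bullet> b) * dir_deriv b F x)"
    by (simp add: linear_sum[OF lin] linear_scale[OF lin])
  finally show ?thesis by simp
qed

lemma integrable_continuous_compact_support:
  fixes f :: "'a::euclidean_space \<Rightarrow> real"
  assumes "compact K" "continuous_on K f" "\<And>x. x \<notin> K \<Longrightarrow> f x = 0"
  shows "integrable lborel f"
proof -
  have "f = (\<lambda>x. indicator K x *\<^sub>R f x)" using assms(3) by (auto simp: indicator_def fun_eq_iff)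
  then show ?thesis using borel_integrable_compact[OF assms(1,2)] by simp
qed

text \<open>Translation invariance of Lebesgue measure: the difference quotients in direction \<open>v\<close> have integral 0,
and they converge to the derivative boundedly, with supports in a common ball.\<close>

lemma integral_derivative_compact_support:
  fixes h :: "'a::euclidean_space \<Rightarrow> real"
  assumes der: "\<And>x. (h has_derivative h' x) (at x)"
    and cont: "continuous_on UNIV (\<lambda>x. h' x v)"
    and supp: "\<And>x. norm x > R \<Longrightarrow> h x = 0"
  shows "(\<integral>x. h' x v \<partial>lborel) = 0"
proof -
  define q where "q n x = real (Suc n) * (h (x + (1 / Suc n) *\<^sub>R v) - h x)" for n x
  define K where "K = cball (0::'a) (\<bar>R\<bar> + norm v)"
  have hc: "continuous_on S h" for S
    using der by (meson continuous_at_imp_continuous_on has_derivative_continuous)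
  have hi: "integrable lborel h"
    by (rule integrable_continuous_compact_support[of "cball 0 R"]) (use hc supp in auto)
  have supp': "h' x v = 0" if "norm x > R" for x
  proof -
    have "((\<lambda>x. 0) has_derivative h' x) (at x)"
      by (rule has_derivative_cong_open[OF der, of "{y. norm y > R}"])
         (use that supp in \<open>auto intro: open_Collect_less continuous_intros\<close>)
    then show ?thesis using has_derivative_unique[OF _ has_derivative_const[of 0]] by (metis)
  qed
  obtain B where B: "\<And>x. x \<in> cball 0 \<bar>R\<bar> \<Longrightarrow> norm (h' x v) \<le> B" "B > 0"
    using compact_imp_bounded[OF compact_continuous_image[OF continuous_on_subset[OF cont] compact_cball[of 0 "\<bar>R\<bar>"]]]
    unfolding bounded_pos by (metis image_eqI subset_UNIV)
  have B': "\<bar>h' x v\<bar> \<le> B" for x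
    using B(1)[of x] supp'[of x] B(2) by (cases "norm x \<le> \<bar>R\<bar>") auto
  have line: "((\<lambda>t::real. h (x + t *\<^sub>R v)) has_real_derivative h' (x + t *\<^sub>R v) v) (at t)" for x t
  proof -
    have "((\<lambda>t::real. h (x + t *\<^sub>R v)) has_derivative (\<lambda>s. h' (x + t *\<^sub>R v) (s *\<^sub>R v))) (at t)"
      by (rule has_derivative_compose[where s=UNIV and f="\<lambda>t. x + t *\<^sub>R v", OF _ der]) (auto intro!: derivative_eq_intros)
    moreover have "h' y (s *\<^sub>R v) = h' y v * s" for y s
      using linear_scale[OF has_derivative_linear[OF der[of y]], of s v] by simp
    ultimately show ?thesis unfolding has_field_derivative_def by simp
  qed
  have qbound: "\<bar>q n x\<bar> \<le> B" for n x
  proof -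
    have "\<exists>z>0. z < 1 / real (Suc n) \<and>
       h (x + (1 / real (Suc n)) *\<^sub>R v) - h (x + 0 *\<^sub>R v) = (1 / real (Suc n) - 0) * h' (x + z *\<^sub>R v) v"
      by (rule MVT2[of 0 "1 / real (Suc n)" "\<lambda>t. h (x + t *\<^sub>R v)"]) (use line in auto)
    then obtain z where "h (x + (1 / real (Suc n)) *\<^sub>R v) - h x = (1 / real (Suc n)) * h' (x + z *\<^sub>R v) v"
      by auto
    then have "q n x = h' (x + z *\<^sub>R v) v" by (simp add: q_def del: of_nat_Suc)
    then show ?thesis using B' by simp
  qed
  have qlim: "(\<lambda>n. q n x) \<longlonglongrightarrow> h' x v" for x
  proof -
    have "((\<lambda>t. (h (x + t *\<^sub>R v) - h (x + 0 *\<^sub>R v)) / (t - 0)) \<longlongrightarrow> h' (x + 0 *\<^sub>R v) v) (at 0)"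
      using line[of x 0] by (simp add: has_field_derivative_iff)
    moreover have "filterlim (\<lambda>n. 1 / real (Suc n)) (at 0) sequentially"
      unfolding filterlim_at using LIMSEQ_Suc[OF lim_1_over_n] by (auto simp del: of_nat_Suc)
    ultimately have "((\<lambda>n. (h (x + (1 / real (Suc n)) *\<^sub>R v) - h (x + 0 *\<^sub>R v)) / (1 / real (Suc n) - 0)) \<longlonglongrightarrow> h' (x + 0 *\<^sub>R v) v)"
      by (rule filterlim_compose)
    then show ?thesis by (simp add: q_def mult.commute del: of_nat_Suc)
  qed
  have qsupp: "q n x = 0" if "x \<notin> K" for n x
  proof -
    have "norm x > \<bar>R\<bar> + norm v" using that by (simp add: K_def)
    moreover have "norm x \<le> norm (x + (1 / Suc n) *\<^sub>R v) + norm ((1 / Suc n) *\<^sub>R v)"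
      using norm_triangle_ineq4[of "x + (1 / Suc n) *\<^sub>R v" "(1 / Suc n) *\<^sub>R v"] by simp
    moreover have "norm ((1 / Suc n) *\<^sub>R v) \<le> norm v"
      by (simp add: mult_left_le_one_le field_simps)
    ultimately have "norm x > R" "norm (x + (1 / Suc n) *\<^sub>R v) > R" using norm_ge_zero[of v] by linarith+
    then show ?thesis using supp by (simp add: q_def)
  qed
  have trans: "integrable lborel (\<lambda>x. h (x + u))" "(\<integral>x. h (x + u) \<partial>lborel) = (\<integral>x. h x \<partial>lborel)" for u
  proof -
    have m: "(\<lambda>x. u + x) \<in> measurable lborel borel" by measurable
    have hm: "h \<in> borel_measurable borel" using hc by (rule borel_measurable_continuous_onI)
    have "integrable (distr lborel borel ((+) u)) h" using hi by (simp add: lborel_distr_plus)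
    from integrable_distr[OF m this] show "integrable lborel (\<lambda>x. h (x + u))" by (simp add: add.commute)
    show "(\<integral>x. h (x + u) \<partial>lborel) = (\<integral>x. h x \<partial>lborel)"
      using integral_distr[OF m hm, unfolded lborel_distr_plus] by (simp add: add.commute)
  qed
  have qint: "(\<integral>x. q n x \<partial>lborel) = 0" for n
  proof -
    have "(\<integral>x. q n x \<partial>lborel) = real (Suc n) * ((\<integral>x. h (x + (1 / Suc n) *\<^sub>R v) \<partial>lborel) - (\<integral>x. h x \<partial>lborel))"
      unfolding q_def integral_mult_right_zero
      by (simp only: Bochner_Integration.integral_diff[OF trans(1) hi])
    then show ?thesis unfolding trans(2) by simp
  qed
  have "(\<lambda>n. \<integral>x. q n x \<partial>lborel) \<longlonglongrightarrow> (\<integral>x. h' x v \<partial>lborel)"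
  proof (rule integral_dominated_convergence[where w="\<lambda>x. indicator K x * B"])
    show "(\<lambda>x. h' x v) \<in> borel_measurable lborel" using borel_measurable_continuous_onI[OF cont] by simp
    show "q n \<in> borel_measurable lborel" for n
    proof -
      have "continuous_on UNIV (q n)" unfolding q_def
        by (intro continuous_intros continuous_on_compose2[OF hc[of UNIV]] hc) auto
      then show ?thesis using borel_measurable_continuous_onI by auto
    qed
    show "integrable lborel (\<lambda>x. indicator K x * B)"
      using borel_integrable_compact[of K "\<lambda>_. B"] by (simp add: K_def)
    show "AE x in lborel. (\<lambda>i. q i x) \<longlonglongrightarrow> h' x v" using qlim by simp
    show "AE x in lborel. norm (q i x) \<le> indicator K x * B" for i
      using qbound[of i] qsupp[of _ i] by (auto simp: indicator_def)
  qed
  then show ?thesis unfolding qint by (simp add: LIMSEQ_const_iff)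
qed

section \<open>The inner product of the sphere and the symmetry of its Laplacian\<close>

text \<open>The square of the positive part is the simplest function that vanishes on a half-line and is still
continuously differentiable; it is the cutoff below.\<close>

lemma has_real_derivative_max_0_squared:
  "((\<lambda>t::real. (max 0 t)\<^sup>2) has_real_derivative 2 * max 0 t) (at t)"
proof (cases t "0::real" rule: linorder_cases)
  case greater
  have "((\<lambda>t::real. t\<^sup>2) has_real_derivative 2 * max 0 t) (at t)"
    using greater by (auto intro!: derivative_eq_intros)
  then show ?thesis
    by (rule has_field_derivative_transform_within_open[of _ _ _ "{0<..}"]) (use greater in auto)
next
  case less
  have "((\<lambda>t::real. 0) has_real_derivative 2 * max 0 t) (at t)"
    using less by (auto intro!: derivative_eq_intros)
  then show ?thesis
    by (rule has_field_derivative_transform_within_open[of _ _ _ "{..<0}"]) (use less in auto)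
next
  case equal
  have "((\<lambda>h::real. ((max 0 h)\<^sup>2 - (max 0 0)\<^sup>2) / (h - 0)) \<longlongrightarrow> 0) (at 0)"
  proof (rule Lim_null_comparison)
    show "\<forall>\<^sub>F h in at 0. norm (((max 0 h)\<^sup>2 - (max 0 0)\<^sup>2) / (h - 0)) \<le> \<bar>h::real\<bar>"
      by (intro always_eventually allI) (auto simp: max_def power2_eq_square)
    show "((\<lambda>h::real. \<bar>h\<bar>) \<longlongrightarrow> 0) (at 0)" by (auto intro!: tendsto_eq_intros)
  qed
  then show ?thesis using equal by (simp add: has_field_derivative_iff)
qed

text \<open>A radial \<open>C\<^sup>1\<close> bump on the annulus \<open>1 < \<parallel>x\<parallel> < 2\<close>. Integrating degree-0 homogeneous functions against
it gives, up to a constant factor, the integral over the sphere; so surface measure and polar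
coordinates can be avoided, and integration by parts has no boundary terms.\<close>

definition annular_weight :: "'a::euclidean_space \<Rightarrow> real" where
  "annular_weight x = (max 0 ((x \<bullet> x - 1) * (4 - x \<bullet> x)))\<^sup>2"

text \<open>As the weight is radial, its gradient at \<open>x\<close> is a multiple of \<open>x\<close>; this is the factor.\<close>

definition annular_weight_slope :: "'a::euclidean_space \<Rightarrow> real" where
  "annular_weight_slope x = 4 * max 0 ((x \<bullet> x - 1) * (4 - x \<bullet> x)) * (5 - 2 * (x \<bullet> x))"

lemma has_derivative_annular_weight:
  "(annular_weight has_derivative (\<lambda>v. annular_weight_slope x * (x \<bullet> v))) (at x)"
proof -
  have 1: "((\<lambda>x. (x \<bullet> x - 1) * (4 - x \<bullet> x)) has_derivative (\<lambda>v. 2 * (5 - 2 * (x \<bullet> x)) * (x \<bullet> v))) (at x)"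
    by (auto intro!: derivative_eq_intros simp: algebra_simps inner_commute fun_eq_iff)
  have "((\<lambda>x. (max 0 ((x \<bullet> x - 1) * (4 - x \<bullet> x)))\<^sup>2) has_derivative
     (\<lambda>v. 2 * max 0 ((x \<bullet> x - 1) * (4 - x \<bullet> x)) * (2 * (5 - 2 * (x \<bullet> x)) * (x \<bullet> v)))) (at x)"
    by (rule has_derivative_compose[OF 1
          has_real_derivative_max_0_squared[unfolded has_field_derivative_def]])
  then show ?thesis
    unfolding annular_weight_def[abs_def] annular_weight_slope_def
    by (rule has_derivative_eq_rhs) (simp add: fun_eq_iff algebra_simps)
qed

lemma continuous_on_annular_weight: "continuous_on S annular_weight"
  unfolding annular_weight_def[abs_def] by (intro continuous_intros)

lemma continuous_on_annular_weight_slope: "continuous_on S annular_weight_slope"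
  unfolding annular_weight_slope_def[abs_def] by (intro continuous_intros)

lemma annular_weight_nonneg: "annular_weight x \<ge> 0"
  by (simp add: annular_weight_def)

lemma annular_weight_pos:
  assumes "1 < norm x" "norm x < 2" shows "annular_weight x > 0"
proof -
  have "norm x * norm x > 1 * 1" "norm x * norm x < 2 * 2"
    using assms mult_strict_mono[of 1 "norm x" 1 "norm x"] mult_strict_mono[of "norm x" 2 "norm x" 2] by fastforce+
  then have "(x \<bullet> x - 1) * (4 - x \<bullet> x) > 0" by (simp add: dot_square_norm power2_eq_square)
  then show ?thesis unfolding annular_weight_def by (simp only: zero_less_power max.absorb2 less_imp_le)
qed

lemma annular_weight_eq_0:
  assumes "norm x < 1 \<or> norm x > 2"
  shows "annular_weight x = 0" "annular_weight_slope x = 0"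
proof -
  have "norm x * norm x \<le> 1 * 1 \<or> norm x * norm x \<ge> 2 * 2"
    using assms mult_mono[of "norm x" 1 "norm x" 1] mult_mono[of 2 "norm x" 2 "norm x"] by auto
  then have "(x \<bullet> x - 1) * (4 - x \<bullet> x) \<le> 0"
    by (auto simp: dot_square_norm power2_eq_square mult_le_0_iff)
  then have "max 0 ((x \<bullet> x - 1) * (4 - x \<bullet> x)) = 0" by simp
  then show "annular_weight x = 0" "annular_weight_slope x = 0"
    unfolding annular_weight_def annular_weight_slope_def by simp_all
qed

lemma integrable_annular_weight_mult:
  fixes G :: "'a::euclidean_space \<Rightarrow> real"
  assumes "continuous_on (- {0}) G"
  shows "integrable lborel (\<lambda>x. annular_weight x * G x)"
proof (rule integrable_continuous_compact_support)
  show "compact (cball 0 2 - ball (0::'a) 1)" by (simp add: compact_diff)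
  show "continuous_on (cball 0 2 - ball 0 1) (\<lambda>x. annular_weight x * G x)"
    by (intro continuous_intros continuous_on_annular_weight continuous_on_subset[OF assms]) auto
  show "annular_weight x * G x = 0" if "x \<notin> cball 0 2 - ball 0 1" for x
    using that by (auto simp: annular_weight_eq_0)
qed

definition sphere_inner :: "('a::euclidean_space \<Rightarrow> real) \<Rightarrow> ('a \<Rightarrow> real) \<Rightarrow> real" where
  "sphere_inner f g = (\<integral>x. annular_weight x * (f (sgn x) * g (sgn x)) \<partial>lborel)"

lemma continuous_on_comp_sgn:
  fixes f :: "'a::euclidean_space \<Rightarrow> real"
  assumes "continuous_on (sphere 0 1) f"
  shows "continuous_on (- {0}) (\<lambda>x. f (sgn x))"
proof (rule continuous_on_compose2[OF assms])
  show "continuous_on (- {0::'a}) sgn"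
    unfolding sgn_div_norm[abs_def] by (intro continuous_intros) auto
  show "sgn ` (- {0::'a}) \<subseteq> sphere 0 1" by (auto simp: norm_sgn split: if_splits)
qed

lemma sphere_inner_integrable:
  fixes f g :: "'a::euclidean_space \<Rightarrow> real"
  assumes "continuous_on (sphere 0 1) f" "continuous_on (sphere 0 1) g"
  shows "integrable lborel (\<lambda>x. annular_weight x * (f (sgn x) * g (sgn x)))"
  by (intro integrable_annular_weight_mult continuous_intros continuous_on_comp_sgn assms)

lemma sphere_inner_commute: "sphere_inner f g = sphere_inner g f"
  by (simp add: sphere_inner_def mult.commute)

lemma sphere_inner_cong:
  assumes "\<And>x. x \<in> sphere 0 1 \<Longrightarrow> f x = f' x" "\<And>x. x \<in> sphere 0 1 \<Longrightarrow> g x = g' x"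
  shows "sphere_inner f g = sphere_inner f' g'"
  unfolding sphere_inner_def
proof (rule Bochner_Integration.integral_cong[OF refl])
  fix x :: 'a
  show "annular_weight x * (f (sgn x) * g (sgn x)) = annular_weight x * (f' (sgn x) * g' (sgn x))"
    using assms[of "sgn x"] annular_weight_eq_0[of x] by (cases "x = 0") (auto simp: norm_sgn)
qed

lemma sphere_inner_add_right:
  assumes "continuous_on (sphere 0 1) f" "continuous_on (sphere 0 1) g" "continuous_on (sphere 0 1) h"
  shows "sphere_inner f (\<lambda>x. g x + h x) = sphere_inner f g + sphere_inner f h"
  unfolding sphere_inner_def
  using Bochner_Integration.integral_add[OF sphere_inner_integrable[OF assms(1,2)] sphere_inner_integrable[OF assms(1,3)]]
  by (simp add: algebra_simps)

lemma sphere_inner_mult_right: "sphere_inner f (\<lambda>x. c * g x) = c * sphere_inner f g"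
  unfolding sphere_inner_def integral_mult_right_zero[symmetric] by (simp add: mult_ac)

lemma sphere_inner_mult_left: "sphere_inner (\<lambda>x. c * f x) g = c * sphere_inner f g"
  unfolding sphere_inner_def integral_mult_right_zero[symmetric] by (simp add: mult_ac)

lemma sphere_inner_zero_right: "sphere_inner f (\<lambda>x. 0) = 0"
  by (simp add: sphere_inner_def)

lemma sphere_inner_add_left:
  assumes "continuous_on (sphere 0 1) f" "continuous_on (sphere 0 1) g" "continuous_on (sphere 0 1) h"
  shows "sphere_inner (\<lambda>x. g x + h x) f = sphere_inner g f + sphere_inner h f"
  using sphere_inner_add_right[OF assms] by (simp add: sphere_inner_commute)

lemma sphere_inner_sum_right:
  assumes "continuous_on (sphere 0 1) f" "\<And>i. i \<in> I \<Longrightarrow> continuous_on (sphere 0 1) (g i)"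
  shows "sphere_inner f (\<lambda>x. \<Sum>i\<in>I. g i x) = (\<Sum>i\<in>I. sphere_inner f (g i))"
  using assms(2)
proof (induction I rule: infinite_finite_induct)
  case (insert i I)
  then show ?case
    using sphere_inner_add_right[OF assms(1), of "g i" "\<lambda>x. \<Sum>i\<in>I. g i x"]
    by (simp add: continuous_on_sum)
qed (simp_all add: sphere_inner_zero_right)

text \<open>The integrand is continuous and nonnegative, so it vanishes identically; it is evaluated at a point of
the annulus, where the weight is positive.\<close>

lemma sphere_inner_self_eq_0:
  fixes f :: "'a::euclidean_space \<Rightarrow> real"
  assumes cont: "continuous_on (sphere 0 1) f" and 0: "sphere_inner f f = 0" and x: "x \<in> sphere 0 1"
  shows "f x = 0"
proof -
  define \<phi> where "\<phi> x = annular_weight x * (f (sgn x) * f (sgn x))" for x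
  have "continuous_on (- {0}) \<phi>" unfolding \<phi>_def
    by (intro continuous_intros continuous_on_comp_sgn cont continuous_on_annular_weight)
  moreover have "continuous_on (ball 0 1) \<phi>"
    by (rule continuous_on_cong[THEN iffD1, OF refl _ continuous_on_const[of _ 0]])
       (auto simp: \<phi>_def annular_weight_eq_0)
  ultimately have "continuous_on (- {0} \<union> ball 0 1) \<phi>" by (intro continuous_on_open_Un) auto
  moreover have "- {0} \<union> ball (0::'a) 1 = UNIV" by auto
  ultimately have contp: "continuous_on UNIV \<phi>" by simp
  have "(\<integral>x. \<phi> x \<partial>lborel) = 0" using 0 by (simp add: \<phi>_def sphere_inner_def)
  moreover have "integrable lborel \<phi>" unfolding \<phi>_def by (rule sphere_inner_integrable[OF cont cont])
  moreover have "AE x in lborel. 0 \<le> \<phi> x" by (simp add: \<phi>_def annular_weight_nonneg)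
  ultimately have ae: "AE x in lborel. \<phi> x = 0" using integral_nonneg_eq_0_iff_AE by blast
  have "closed {x. \<phi> x = 0}" using closed_Collect_eq[OF contp continuous_on_const] by simp
  then have "(3/2) *\<^sub>R x \<in> {x. \<phi> x = 0}"
    using mem_closed_if_AE_lebesgue[of "{x. \<phi> x = 0}"] AE_completion[OF ae] by simp
  moreover have "annular_weight ((3/2) *\<^sub>R x) > 0" using x by (intro annular_weight_pos) auto
  moreover have "sgn ((3/2) *\<^sub>R x) = x" using x by (simp add: sgn_div_norm)
  ultimately show ?thesis by (simp add: \<phi>_def)
qed

lemma C2_on_continuous:
  assumes "C2_on (- {0}) (radial_ext f)"
  shows "continuous_on (- {0}) (radial_ext f)" "continuous_on (- {0}) (dir_deriv u (radial_ext f))"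
    "continuous_on (sphere 0 1) f"
proof -
  show 1: "continuous_on (- {0}) (radial_ext f)" "continuous_on (- {0}) (dir_deriv u (radial_ext f))"
    using assms unfolding C2_on_def
    by (meson continuous_at_imp_continuous_on differentiable_imp_continuous_within)+
  have "continuous_on (sphere 0 1) (radial_ext f)" by (rule continuous_on_subset[OF 1(1)]) auto
  then show "continuous_on (sphere 0 1) f"
    by (rule continuous_on_cong[THEN iffD1, rotated 2]) (auto simp: radial_ext_def sgn_div_norm)
qed

text \<open>Green's identity. The vector field \<open>F \<nabla>G - G \<nabla>F\<close> has divergence \<open>F \<Delta>G - G \<Delta>F\<close>, and it is orthogonal
to \<open>x\<close> because \<open>F\<close> and \<open>G\<close> are constant along rays. Multiplying it by a radial function of compact
support away from 0 therefore only multiplies its divergence by that function, and the divergence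
theorem is the vanishing of the integral of a derivative. The factor \<open>x \<bullet> x\<close> in the cutoff compensates
the degree \<open>- 2\<close> of the Laplacians.\<close>

theorem sphere_inner_laplacian_symmetric:
  fixes f g :: "'a::euclidean_space \<Rightarrow> real"
  assumes f: "C2_on (- {0}) (radial_ext f)" and g: "C2_on (- {0}) (radial_ext g)"
  shows "sphere_inner f (sphere_laplacian g) = sphere_inner (sphere_laplacian f) g"
proof -
  let ?F = "radial_ext f" and ?G = "radial_ext g"
  define V where "V b x = ?F x * dir_deriv b ?G x - ?G x * dir_deriv b ?F x" for b x
  \<comment> \<open>The cutoff, with gradient \<open>C x *\<^sub>R x\<close>; multiplied by \<open>V b\<close> it is the component of the field along \<open>b\<close>.\<close>
  define \<rho> where "\<rho> x = (x \<bullet> x) * annular_weight x" for x :: 'a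
  define C where "C x = (x \<bullet> x) * annular_weight_slope x + 2 * annular_weight x" for x :: 'a
  define E where "E b v x = ?F x * dir_deriv v (dir_deriv b ?G) x - ?G x * dir_deriv v (dir_deriv b ?F) x" for b v x
  \<comment> \<open>\<open>V b\<close> need not be differentiable at the origin, but the cutoff vanishes near it.\<close>
  define h' where "h' b x v = (if x = 0 then 0 else
     \<rho> x * (E b v x + (dir_deriv v ?F x * dir_deriv b ?G x - dir_deriv v ?G x * dir_deriv b ?F x))
      + C x * (x \<bullet> v) * V b x)" for b x v
  have dF: "?F differentiable (at x)" "dir_deriv u ?F differentiable (at x)"
    and dG: "?G differentiable (at x)" "dir_deriv u ?G differentiable (at x)" if "x \<noteq> 0" for u x
    using f g that by (simp_all add: C2_on_def)
  have chi: "(\<rho> has_derivative (\<lambda>v. C x * (x \<bullet> v))) (at x)" for x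
    unfolding \<rho>_def[abs_def] C_def
    by (auto intro!: derivative_eq_intros has_derivative_annular_weight
        simp: fun_eq_iff algebra_simps inner_commute)
  have small: "\<rho> x = 0" "C x = 0" if "norm x < 1 \<or> norm x > 2" for x
    using annular_weight_eq_0[OF that] by (simp_all add: \<rho>_def C_def)
  have der: "((\<lambda>x. \<rho> x * V b x) has_derivative h' b x) (at x)" for b x
  proof (cases "x = 0")
    case True
    have "((\<lambda>x. \<rho> x * V b x) has_derivative (\<lambda>v. 0)) (at x)"
      by (rule has_derivative_cong_open[OF has_derivative_const, of "ball 0 1"])
         (use True small in auto)
    moreover have "h' b x = (\<lambda>v. 0)" using True by (simp add: h'_def fun_eq_iff)
    ultimately show ?thesis by simp
  next
    case False
    have "(V b has_derivative (\<lambda>v. ?F x * dir_deriv v (dir_deriv b ?G) x + dir_deriv v ?F x * dir_deriv b ?G x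
      - (?G x * dir_deriv v (dir_deriv b ?F) x + dir_deriv v ?G x * dir_deriv b ?F x))) (at x)"
      unfolding V_def[abs_def]
      by (intro has_derivative_diff has_derivative_mult dir_deriv_works dF[OF False] dG[OF False])
    from has_derivative_mult[OF chi this] show ?thesis
      by (rule has_derivative_eq_rhs) (use False in \<open>auto simp: h'_def E_def fun_eq_iff algebra_simps\<close>)
  qed
  have h'bb: "h' b x b = \<rho> x * E b b x + C x * (x \<bullet> b) * V b x" for b x
    using small[of x] by (cases "x = 0") (auto simp: h'_def)
  have cE: "continuous_on (- {0}) (E b b)" for b
    unfolding E_def[abs_def] using C2_on_continuous(1)[OF f] C2_on_continuous(1)[OF g] f g
    by (intro continuous_intros) (auto simp: C2_on_def)
  have cV: "continuous_on (- {0}) (V b)" for b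
    unfolding V_def[abs_def]
    by (intro continuous_intros C2_on_continuous(1)[OF f] C2_on_continuous(1)[OF g]
        C2_on_continuous(2)[OF f] C2_on_continuous(2)[OF g])
  have cont: "continuous_on UNIV (\<lambda>x. h' b x b)" for b
  proof -
    have "continuous_on (- {0}) (\<lambda>x. h' b x b)"
      unfolding h'bb \<rho>_def C_def
      by (intro continuous_intros cE cV continuous_on_annular_weight continuous_on_annular_weight_slope)
    moreover have "continuous_on (ball 0 1) (\<lambda>x. h' b x b)"
      by (rule continuous_on_cong[THEN iffD1, OF refl _ continuous_on_const[of _ 0]])
         (auto simp: h'bb small)
    ultimately have "continuous_on (- {0} \<union> ball 0 1) (\<lambda>x. h' b x b)" by (intro continuous_on_open_Un) auto
    moreover have "- {0} \<union> ball (0::'a) 1 = UNIV" by auto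
    ultimately show ?thesis by simp
  qed
  have int0: "(\<integral>x. h' b x b \<partial>lborel) = 0" for b
    by (rule integral_derivative_compact_support[OF der cont, of 2]) (auto simp: small)
  have inth: "integrable lborel (\<lambda>x. h' b x b)" for b
    by (rule integrable_continuous_compact_support[of "cball 0 2", OF _ continuous_on_subset[OF cont]])
       (auto simp: h'bb small)
  have cS: "continuous_on (sphere 0 1) (sphere_laplacian k)" if "C2_on (- {0}) (radial_ext k)" for k :: "'a \<Rightarrow> real"
    unfolding sphere_laplacian_def[abs_def] laplacian_def[abs_def] using that
    by (intro continuous_intros continuous_on_subset[where t="sphere 0 1"]) (auto simp: C2_on_def)
  have sum: "(\<Sum>b\<in>Basis. h' b x b) = annular_weight x * (f (sgn x) * sphere_laplacian g (sgn x))
        - annular_weight x * (sphere_laplacian f (sgn x) * g (sgn x))" for x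
  proof (cases "x = 0")
    case True then show ?thesis by (simp add: h'_def annular_weight_eq_0)
  next
    case False
    have "(\<Sum>b\<in>Basis. (x \<bullet> b) * V b x) = ?F x * dir_deriv x ?G x - ?G x * dir_deriv x ?F x"
      unfolding sum_coord_dir_deriv[OF dF(1)[OF False], of x, symmetric] sum_coord_dir_deriv[OF dG(1)[OF False], of x, symmetric]
      by (simp add: V_def sum_distrib_left right_diff_distrib sum_subtractf mult_ac)
    also have "\<dots> = 0"
      using dir_deriv_radial_ext_radial[OF dF(1)[OF False] False] dir_deriv_radial_ext_radial[OF dG(1)[OF False] False]
      by simp
    finally have 0: "(\<Sum>b\<in>Basis. (x \<bullet> b) * V b x) = 0" .
    have "(\<Sum>b\<in>Basis. h' b x b) = \<rho> x * (\<Sum>b\<in>Basis. E b b x) + C x * (\<Sum>b\<in>Basis. (x \<bullet> b) * V b x)"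
      unfolding h'bb by (simp add: sum.distrib sum_distrib_left mult_ac)
    also have "\<dots> = \<rho> x * (?F x * laplacian ?G x - ?G x * laplacian ?F x)"
      unfolding 0 by (simp add: E_def laplacian_def sum_subtractf sum_distrib_left)
    also have "\<dots> = annular_weight x * (?F x * ((x \<bullet> x) * laplacian ?G x)) - annular_weight x * ((x \<bullet> x) * laplacian ?F x * ?G x)"
      by (simp add: \<rho>_def algebra_simps)
    finally show ?thesis
      using False unfolding laplacian_radial_ext[OF f False] laplacian_radial_ext[OF g False]
      by (simp add: radial_ext_def)
  qed
  have "(\<integral>x. (\<Sum>b\<in>Basis. h' b x b) \<partial>lborel) = 0"
    using inth int0 by (subst Bochner_Integration.integral_sum) auto
  then show ?thesis
    unfolding sum sphere_inner_def
    using sphere_inner_integrable[OF C2_on_continuous(3)[OF f] cS[OF g]]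
      sphere_inner_integrable[OF cS[OF f] C2_on_continuous(3)[OF g]]
    by (subst (asm) Bochner_Integration.integral_diff) auto
qed

section \<open>Homogeneous polynomials on the sphere\<close>

text \<open>Homogeneous polynomial functions, generated so that inductions run over the structure of the
polynomial. Zero is made homogeneous of every degree, so that each degree is a vector space.\<close>

inductive homog_poly :: "nat \<Rightarrow> ('a::euclidean_space \<Rightarrow> real) \<Rightarrow> bool" where
  homog_poly_const: "homog_poly 0 (\<lambda>x. c)"
| homog_poly_zero: "homog_poly k (\<lambda>x. 0)"
| homog_poly_coord: "b \<in> Basis \<Longrightarrow> homog_poly 1 (\<lambda>x. x \<bullet> b)"
| homog_poly_add: "homog_poly k p \<Longrightarrow> homog_poly k q \<Longrightarrow> homog_poly k (\<lambda>x. p x + q x)"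
| homog_poly_mult: "homog_poly j p \<Longrightarrow> homog_poly k q \<Longrightarrow> homog_poly (j + k) (\<lambda>x. p x * q x)"

lemma homog_poly_sum: "(\<And>i. i \<in> I \<Longrightarrow> homog_poly k (p i)) \<Longrightarrow> homog_poly k (\<lambda>x. \<Sum>i\<in>I. p i x)"
  by (induction I rule: infinite_finite_induct) (simp_all add: homog_poly_zero homog_poly_add)

lemma homog_poly_cmult: "homog_poly k p \<Longrightarrow> homog_poly k (\<lambda>x. c * p x)"
  using homog_poly_mult[OF homog_poly_const[of c], of k p] by simp

lemma homog_poly_power: "homog_poly k p \<Longrightarrow> homog_poly (n * k) (\<lambda>x. p x ^ n)"
proof (induction n)
  case 0 show ?case using homog_poly_const[of 1] by simp
next
  case (Suc n)
  from homog_poly_mult[OF Suc.prems Suc.IH[OF Suc.prems]] show ?case by simp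
qed

lemma homog_poly_prod:
  "finite I \<Longrightarrow> (\<And>i. i \<in> I \<Longrightarrow> homog_poly (k i) (p i)) \<Longrightarrow> homog_poly (\<Sum>i\<in>I. k i) (\<lambda>x. \<Prod>i\<in>I. p i x)"
proof (induction I rule: finite_induct)
  case empty then show ?case using homog_poly_const[of 1] by simp
next
  case (insert i I) then show ?case by (simp add: homog_poly_mult)
qed

lemma homog_poly_scale: "homog_poly k p \<Longrightarrow> p (c *\<^sub>R x) = c ^ k * p x"
  by (induction rule: homog_poly.induct) (simp_all add: algebra_simps power_add)

text \<open>The last conjunct supplies what the truncated degree \<open>0 - 1 = 0\<close> loses: constants have derivative 0.
Without it, the product rule for a factor of degree 0 would give a degree that is too large by 1.\<close>

lemma homog_poly_derivative:
  assumes "homog_poly k p"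
  shows "\<exists>p'. (\<forall>x. (p has_derivative (\<lambda>v. p' v x)) (at x)) \<and> (\<forall>v. homog_poly (k - 1) (p' v))
     \<and> (k = 0 \<longrightarrow> (\<forall>v x. p' v x = 0))"
  using assms
proof (induction rule: homog_poly.induct)
  case (homog_poly_const c)
  show ?case by (rule exI[of _ "\<lambda>v x. 0"]) (simp add: homog_poly.homog_poly_const)
next
  case (homog_poly_zero k)
  show ?case by (rule exI[of _ "\<lambda>v x. 0"]) (simp add: homog_poly.homog_poly_zero)
next
  case (homog_poly_coord b)
  show ?case
    by (rule exI[of _ "\<lambda>v x. v \<bullet> b"]) (auto intro!: homog_poly.homog_poly_const derivative_eq_intros)
next
  case (homog_poly_add k p q)
  then obtain p' q' where *: "\<And>x. (p has_derivative (\<lambda>v. p' v x)) (at x)" "\<And>v. homog_poly (k - 1) (p' v)"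
    "k = 0 \<Longrightarrow> (\<forall>v x. p' v x = 0)" "\<And>x. (q has_derivative (\<lambda>v. q' v x)) (at x)" "\<And>v. homog_poly (k - 1) (q' v)"
    "k = 0 \<Longrightarrow> (\<forall>v x. q' v x = 0)" by metis
  show ?case
    by (intro exI[of _ "\<lambda>v x. p' v x + q' v x"] conjI allI impI homog_poly.homog_poly_add has_derivative_add *)
       (simp_all add: *(3,6))
next
  case (homog_poly_mult j p k q)
  then obtain p' q' where *: "\<And>x. (p has_derivative (\<lambda>v. p' v x)) (at x)" "\<And>v. homog_poly (j - 1) (p' v)"
    "j = 0 \<Longrightarrow> (\<forall>v x. p' v x = 0)" "\<And>x. (q has_derivative (\<lambda>v. q' v x)) (at x)" "\<And>v. homog_poly (k - 1) (q' v)"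
    "k = 0 \<Longrightarrow> (\<forall>v x. q' v x = 0)" by metis
  have "homog_poly (j + k - 1) (\<lambda>x. p x * q' v x)" for v
  proof (cases "k = 0")
    case True then show ?thesis using *(6) by (simp add: homog_poly.homog_poly_zero)
  next
    case False then show ?thesis using homog_poly.homog_poly_mult[OF homog_poly_mult.hyps(1) *(5)[of v]] by simp
  qed
  moreover have "homog_poly (j + k - 1) (\<lambda>x. p' v x * q x)" for v
  proof (cases "j = 0")
    case True then show ?thesis using *(3) by (simp add: homog_poly.homog_poly_zero)
  next
    case False then show ?thesis using homog_poly.homog_poly_mult[OF *(2)[of v] homog_poly_mult.hyps(2)] by simp
  qed
  ultimately show ?case
    by (intro exI[of _ "\<lambda>v x. p x * q' v x + p' v x * q x"] conjI allI impI homog_poly.homog_poly_add has_derivative_mult *(1,4))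
       (simp_all add: *(3,6))
qed

lemma homog_poly_dir_deriv:
  assumes "homog_poly k p"
  shows "p differentiable (at x)" "homog_poly (k - 1) (dir_deriv v p)" "k = 0 \<Longrightarrow> dir_deriv v p x = 0"
proof -
  obtain p' where *: "\<And>x. (p has_derivative (\<lambda>v. p' v x)) (at x)" "\<And>v. homog_poly (k - 1) (p' v)"
     "k = 0 \<Longrightarrow> (\<forall>v x. p' v x = 0)" using homog_poly_derivative[OF assms] by metis
  have "dir_deriv v p x = p' v x" for v x using dir_deriv_eqI[OF *(1)] by simp
  then have e: "dir_deriv v p = p' v" for v by auto
  show "p differentiable (at x)" "homog_poly (k - 1) (dir_deriv v p)" "k = 0 \<Longrightarrow> dir_deriv v p x = 0"
    unfolding e using * by (auto simp: differentiable_def)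
qed

lemma homog_poly_continuous: "homog_poly k p \<Longrightarrow> continuous_on S p"
  using homog_poly_dir_deriv(1) continuous_at_imp_continuous_on differentiable_imp_continuous_within by blast

lemma homog_poly_laplacian:
  assumes "homog_poly k p"
  shows "homog_poly (k - 2) (laplacian p)" "k < 2 \<Longrightarrow> laplacian p x = 0"
proof -
  have "homog_poly (k - 1 - 1) (laplacian p)" unfolding laplacian_def[abs_def]
    by (intro homog_poly_sum homog_poly_dir_deriv(2) assms)
  then show "homog_poly (k - 2) (laplacian p)" by (simp add: numeral_2_eq_2)
  show "laplacian p x = 0" if "k < 2"
    unfolding laplacian_def
    by (intro sum.neutral ballI homog_poly_dir_deriv(3)[OF homog_poly_dir_deriv(2)[OF assms]]) (use that in auto)
qed

text \<open>Euler's identity, from differentiating \<open>p (t x) = t\<^sup>k p x\<close> at \<open>t = 1\<close>.\<close>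

lemma homog_poly_euler:
  fixes p :: "'a::euclidean_space \<Rightarrow> real"
  assumes "homog_poly k p" shows "dir_deriv x p x = real k * p x"
proof -
  have "((\<lambda>t::real. p (t *\<^sub>R x)) has_derivative (\<lambda>s. dir_deriv (s *\<^sub>R x) p (1 *\<^sub>R x))) (at 1)"
    by (rule has_derivative_compose[where f="\<lambda>t. t *\<^sub>R x" and s=UNIV, OF _ dir_deriv_works])
       (use homog_poly_dir_deriv(1)[OF assms] in \<open>auto intro!: derivative_eq_intros\<close>)
  moreover have "((\<lambda>t::real. p (t *\<^sub>R x)) has_derivative (\<lambda>s. s * (real k * p x))) (at 1)"
    unfolding homog_poly_scale[OF assms] by (auto intro!: derivative_eq_intros)
  ultimately have "(\<lambda>s::real. dir_deriv (s *\<^sub>R x) p (1 *\<^sub>R x)) = (\<lambda>s. s * (real k * p x))"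
    by (rule has_derivative_unique)
  from fun_cong[OF this, of 1] show ?thesis by simp
qed

text \<open>Finite sums of homogeneous polynomials of arbitrary degrees. They are closed under products, so they
comprise all polynomial functions, which is how the Stone--Weierstrass theorem is brought to bear.\<close>

inductive sum_of_homog_polys :: "('a::euclidean_space \<Rightarrow> real) \<Rightarrow> bool" where
  base: "homog_poly k p \<Longrightarrow> sum_of_homog_polys p"
| add: "sum_of_homog_polys p \<Longrightarrow> sum_of_homog_polys q \<Longrightarrow> sum_of_homog_polys (\<lambda>x. p x + q x)"

lemma sum_of_homog_polys_closed_sum: "(\<And>i. i \<in> I \<Longrightarrow> sum_of_homog_polys (p i)) \<Longrightarrow> sum_of_homog_polys (\<lambda>x. \<Sum>i\<in>I. p i x)"
  by (induction I rule: infinite_finite_induct)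
     (simp_all add: sum_of_homog_polys.base[OF homog_poly_zero[of 0]] sum_of_homog_polys.add)

lemma sum_of_homog_polys_closed_mult:
  assumes "sum_of_homog_polys p" "sum_of_homog_polys q" shows "sum_of_homog_polys (\<lambda>x. p x * q x)"
  using assms(1)
proof (induction rule: sum_of_homog_polys.induct)
  case (base j p)
  show ?case using assms(2)
  proof (induction rule: sum_of_homog_polys.induct)
    case (base k q) then show ?case using homog_poly_mult \<open>homog_poly j p\<close> sum_of_homog_polys.base by blast
  next
    case (add q r) then show ?case using sum_of_homog_polys.add by (simp add: distrib_left)
  qed
next
  case (add p r) then show ?case using sum_of_homog_polys.add by (simp add: distrib_right)
qed

lemma real_polynomial_function_sum_of_homog_polys:
  "real_polynomial_function p \<Longrightarrow> sum_of_homog_polys p"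
proof (induction rule: real_polynomial_function.induct)
  case (linear f)
  have "f x = (\<Sum>b\<in>Basis. f b * (x \<bullet> b))" for x
  proof -
    have "f x = f (\<Sum>b\<in>Basis. (x \<bullet> b) *\<^sub>R b)" by (simp add: euclidean_representation)
    also have "\<dots> = (\<Sum>b\<in>Basis. f b * (x \<bullet> b))"
      using bounded_linear.linear[OF linear] by (simp add: linear_sum linear_scale mult.commute)
    finally show ?thesis .
  qed
  then have "f = (\<lambda>x. \<Sum>b\<in>Basis. f b * (x \<bullet> b))" by (rule ext)
  moreover have "sum_of_homog_polys (\<lambda>x. \<Sum>b\<in>Basis. f b * (x \<bullet> b))"
    by (intro sum_of_homog_polys_closed_sum sum_of_homog_polys.base[of 1] homog_poly_cmult homog_poly_coord)
  ultimately show ?case by metis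
next
  case (const c) then show ?case by (rule sum_of_homog_polys.base[OF homog_poly_const])
next
  case (add f g) then show ?case by (auto intro: sum_of_homog_polys.add)
next
  case (mult f g) then show ?case by (auto intro: sum_of_homog_polys_closed_mult)
qed

text \<open>Eigenfunctions are represented by functions that vanish off the sphere, so a polynomial has to be cut
off before it can be one.\<close>

definition on_sphere :: "('a::euclidean_space \<Rightarrow> real) \<Rightarrow> 'a \<Rightarrow> real" where
  "on_sphere p x = (if x \<in> sphere 0 1 then p x else 0)"

lemma has_derivative_inverse_norm_power:
  fixes x :: "'a::euclidean_space"
  assumes "x \<noteq> 0"
  shows "((\<lambda>x. inverse (norm x) ^ k) has_derivative
     (\<lambda>v. - (real k * (x \<bullet> v) * inverse (norm x) ^ (k + 2)))) (at x)"
proof -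
  have n: "(norm has_derivative (\<lambda>v. v \<bullet> sgn x)) (at x)" using assms by (rule has_derivative_norm)
  have "((\<lambda>r. inverse r ^ k) has_real_derivative - (real k * inverse (norm x) ^ (k + 1))) (at (norm x))"
  proof (cases k)
    case (Suc m)
    have "((\<lambda>r. inverse r ^ Suc m) has_real_derivative
       real (Suc m) * inverse (norm x) ^ m * - (inverse (norm x) * 1 * inverse (norm x))) (at (norm x))"
      by (rule derivative_eq_intros DERIV_inverse' | use assms in simp)+
    then show ?thesis unfolding Suc by (simp add: mult_ac)
  qed simp
  from has_derivative_compose[OF n this[unfolded has_field_derivative_def]] show ?thesis
    by (rule has_derivative_eq_rhs) (simp add: fun_eq_iff sgn_div_norm inner_commute divide_inverse mult_ac)
qed

lemma radial_ext_on_sphere: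
  assumes "homog_poly k p" "x \<noteq> 0"
  shows "radial_ext (on_sphere p) x = inverse (norm x) ^ k * p x"
  using homog_poly_scale[OF assms(1), of "inverse (norm x)" x] assms(2)
  by (simp add: radial_ext_def on_sphere_def sgn_div_norm)

lemma radial_ext_on_sphere_derivative:
  fixes p :: "'a::euclidean_space \<Rightarrow> real"
  assumes p: "homog_poly k p" and x: "x \<noteq> 0"
  shows "(radial_ext (on_sphere p) has_derivative
     (\<lambda>v. inverse (norm x) ^ k * dir_deriv v p x - real k * (x \<bullet> v) * inverse (norm x) ^ (k + 2) * p x)) (at x)"
    (is "(_ has_derivative ?D) _")
proof -
  have "((\<lambda>x. inverse (norm x) ^ k * p x) has_derivative ?D) (at x)"
    by (rule has_derivative_eq_rhs[OF has_derivative_mult[OF has_derivative_inverse_norm_power[OF x] dir_deriv_works[OF homog_poly_dir_deriv(1)[OF p]]]])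
       (simp add: fun_eq_iff)
  then show ?thesis
    by (rule has_derivative_cong_open[OF _ open_minus_origin]) (use x radial_ext_on_sphere[OF p] in auto)
qed

text \<open>The radial extension of \<open>p\<close> is \<open>\<parallel>x\<parallel>\<^sup>-\<^sup>k p\<close>; its second derivatives come from the product rule.\<close>

lemma radial_ext_on_sphere_derivative2:
  fixes p :: "'a::euclidean_space \<Rightarrow> real"
  assumes p: "homog_poly k p" and x: "x \<noteq> 0"
  shows "(dir_deriv u (radial_ext (on_sphere p)) has_derivative
     (\<lambda>v. inverse (norm x) ^ k * dir_deriv v (dir_deriv u p) x
        - real k * ((x \<bullet> v) * dir_deriv u p x + (x \<bullet> u) * dir_deriv v p x + (v \<bullet> u) * p x) * inverse (norm x) ^ (k + 2)
        + real k * real (k + 2) * (x \<bullet> u) * (x \<bullet> v) * inverse (norm x) ^ (k + 4) * p x)) (at x)"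
    (is "(_ has_derivative ?D) _")
proof -
  let ?G = "\<lambda>x. inverse (norm x) ^ k * dir_deriv u p x - (real k * (x \<bullet> u)) * (inverse (norm x) ^ (k + 2) * p x)"
  note N = has_derivative_inverse_norm_power[OF x]
  note P = dir_deriv_works[OF homog_poly_dir_deriv(1)[OF p]]
  note PU = dir_deriv_works[OF homog_poly_dir_deriv(1)[OF homog_poly_dir_deriv(2)[OF p]]]
  have L: "((\<lambda>x. real k * (x \<bullet> u)) has_derivative (\<lambda>v. real k * (v \<bullet> u))) (at x)"
    by (auto intro!: derivative_eq_intros)
  have "(?G has_derivative ?D) (at x)"
    by (rule has_derivative_eq_rhs[OF has_derivative_diff[OF has_derivative_mult[OF N PU]
          has_derivative_mult[OF L has_derivative_mult[OF N P]]]])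
       (simp add: fun_eq_iff algebra_simps numeral_eq_Suc)
  then show ?thesis
    by (rule has_derivative_cong_open[OF _ open_minus_origin])
       (use x dir_deriv_eqI[OF radial_ext_on_sphere_derivative[OF p]] in \<open>auto simp: mult_ac\<close>)
qed

lemma C2_on_radial_ext_on_sphere:
  assumes p: "homog_poly k p" shows "C2_on (- {0}) (radial_ext (on_sphere p))"
proof -
  have "continuous_on (- {0}) (dir_deriv v (dir_deriv u (radial_ext (on_sphere p))))" for u v
  proof (rule continuous_on_cong[THEN iffD1, OF refl])
    show "inverse (norm x) ^ k * dir_deriv v (dir_deriv u p) x
        - real k * ((x \<bullet> v) * dir_deriv u p x + (x \<bullet> u) * dir_deriv v p x + (v \<bullet> u) * p x) * inverse (norm x) ^ (k + 2)
        + real k * real (k + 2) * (x \<bullet> u) * (x \<bullet> v) * inverse (norm x) ^ (k + 4) * p x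
       = dir_deriv v (dir_deriv u (radial_ext (on_sphere p))) x" if "x \<in> - {0}" for x
      using dir_deriv_eqI[OF radial_ext_on_sphere_derivative2[OF p]] that by simp
    show "continuous_on (- {0}) (\<lambda>x. inverse (norm x) ^ k * dir_deriv v (dir_deriv u p) x
        - real k * ((x \<bullet> v) * dir_deriv u p x + (x \<bullet> u) * dir_deriv v p x + (v \<bullet> u) * p x) * inverse (norm x) ^ (k + 2)
        + real k * real (k + 2) * (x \<bullet> u) * (x \<bullet> v) * inverse (norm x) ^ (k + 4) * p x)"
      by (intro continuous_intros homog_poly_continuous[OF p] homog_poly_continuous[OF homog_poly_dir_deriv(2)[OF p]]
          homog_poly_continuous[OF homog_poly_dir_deriv(2)[OF homog_poly_dir_deriv(2)[OF p]]]) auto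
  qed
  then show ?thesis unfolding C2_on_def
    using differentiableI[OF radial_ext_on_sphere_derivative[OF p]]
      differentiableI[OF radial_ext_on_sphere_derivative2[OF p]] by blast
qed

text \<open>Taking the trace of the second derivative at \<open>\<parallel>x\<parallel> = 1\<close> and using Euler's identity for the cross terms
gives \<open>- 2 k\<^sup>2 - k n + k (k + 2) = - k (k + n - 2)\<close> as the coefficient of \<open>p\<close>.\<close>

lemma sphere_laplacian_on_sphere:
  fixes p :: "'a::euclidean_space \<Rightarrow> real"
  assumes p: "homog_poly k p" and x: "x \<in> sphere 0 1"
  shows "sphere_laplacian (on_sphere p) x = laplacian p x - real k * (real k + real DIM('a) - 2) * p x"
proof -
  have n: "norm x = 1" and x0: "x \<noteq> 0" using x by auto
  have e: "(\<Sum>b\<in>Basis. (x \<bullet> b) * dir_deriv b p x) = real k * p x"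
    using sum_coord_dir_deriv[OF homog_poly_dir_deriv(1)[OF p], of x x] homog_poly_euler[OF p] by simp
  have xx: "(\<Sum>b\<in>Basis. (x \<bullet> b) * (x \<bullet> b)) = 1"
    using n euclidean_inner[of x x] by (simp add: dot_square_norm)
  have "sphere_laplacian (on_sphere p) x = (\<Sum>b\<in>Basis. dir_deriv b (dir_deriv b p) x
        - real k * (2 * ((x \<bullet> b) * dir_deriv b p x) + p x)
        + real k * real (k + 2) * ((x \<bullet> b) * (x \<bullet> b)) * p x)"
    unfolding sphere_laplacian_def laplacian_def
    by (intro sum.cong refl, subst dir_deriv_eqI[OF radial_ext_on_sphere_derivative2[OF p x0]])
       (simp add: n algebra_simps)
  also have "\<dots> = laplacian p x - real k * (2 * (\<Sum>b\<in>Basis. (x \<bullet> b) * dir_deriv b p x) + real DIM('a) * p x)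
     + real k * real (k + 2) * (\<Sum>b\<in>Basis. (x \<bullet> b) * (x \<bullet> b)) * p x"
    by (simp add: sum.distrib sum_subtractf sum_distrib_left sum_distrib_right laplacian_def mult_ac distrib_left)
  also have "\<dots> = laplacian p x - real k * (real k + real DIM('a) - 2) * p x"
    unfolding e xx by (simp add: algebra_simps)
  finally show ?thesis .
qed

section \<open>Linear independence in spaces of functions\<close>

interpretation funs: vector_space "\<lambda>(c::real) f (x::'a). c * f x"
  by unfold_locales (auto simp: fun_eq_iff algebra_simps)

lemma sum_fun_apply: "(\<Sum>i\<in>I. f i) x = (\<Sum>i\<in>I. f i x :: real)"
  by (induction I rule: infinite_finite_induct) auto

text \<open>The map \<open>T\<close> is only required to be linear on a subspace: the inner product with a fixed function and
the Laplacian are linear only where the functions are integrable or differentiable.\<close>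

lemma independent_image_of_injective:
  fixes T :: "('a \<Rightarrow> real) \<Rightarrow> ('b \<Rightarrow> real)"
  assumes V: "funs.subspace V" and C: "C \<subseteq> V" "funs.independent C"
    and add: "\<And>f g. f \<in> V \<Longrightarrow> g \<in> V \<Longrightarrow> T (f + g) = T f + T g"
    and scale: "\<And>f c. f \<in> V \<Longrightarrow> T (\<lambda>x. c * f x) = (\<lambda>x. c * T f x)"
    and ker: "\<And>f. f \<in> funs.span C \<Longrightarrow> T f = 0 \<Longrightarrow> f = 0"
  shows "inj_on T C" "funs.independent (T ` C)"
proof -
  have T0: "T 0 = 0"
    using scale[OF funs.subspace_0[OF V], of 0] by (simp add: zero_fun_def)
  have lin: "T (\<Sum>v\<in>S. (\<lambda>x. u v * v x)) = (\<Sum>v\<in>S. (\<lambda>x. u v * T v x)) \<and> (\<Sum>v\<in>S. (\<lambda>x. u v * v x)) \<in> V"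
    if "finite S" "S \<subseteq> C" for S u
    using that
  proof (induction S rule: finite_induct)
    case empty then show ?case using T0 funs.subspace_0[OF V] by (simp add: zero_fun_def)
  next
    case (insert v S)
    then have 1: "(\<lambda>x. u v * v x) \<in> V" "v \<in> V" using C(1) funs.subspace_scale[OF V] by blast+
    have 2: "T (\<Sum>v\<in>S. (\<lambda>x. u v * v x)) = (\<Sum>v\<in>S. (\<lambda>x. u v * T v x))" "(\<Sum>v\<in>S. (\<lambda>x. u v * v x)) \<in> V"
      using insert by auto
    show ?case unfolding sum.insert[OF insert(1,2)] add[OF 1(1) 2(2)] 2(1) scale[OF 1(2)]
      using funs.subspace_add[OF V 1(1) 2(2)] by (intro conjI refl)
  qed
  show inj: "inj_on T C"
  proof (rule inj_onI)
    fix v w assume vw: "v \<in> C" "w \<in> C" "T v = T w"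
    have nw: "(\<lambda>x. -1 * w x) \<in> V" using funs.subspace_scale[OF V, of w "-1"] C(1) vw by auto
    have "T (v + (\<lambda>x. -1 * w x)) = T v + (\<lambda>x. -1 * T w x)"
      using add[OF _ nw, of v] scale[of w "-1"] vw(1,2) subsetD[OF C(1)] by simp
    also have "\<dots> = 0" using vw(3) by (simp add: fun_eq_iff)
    finally have "v + (\<lambda>x. -1 * w x) = 0"
      by (intro ker funs.span_add funs.span_scale[where c="-1"] funs.span_base vw)
    then show "v = w" by (simp add: fun_eq_iff)
  qed
  show "funs.independent (T ` C)"
    unfolding funs.independent_explicit_finite_subsets
  proof (intro allI impI ballI)
    fix S u w assume S: "S \<subseteq> T ` C" "finite S" "(\<Sum>v\<in>S. (\<lambda>x. u v * v x)) = 0" "w \<in> S"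
    obtain R where R: "R \<subseteq> C" "S = T ` R" "finite R" using S(1,2) by (meson finite_subset_image)
    have injR: "inj_on T R" using inj R(1) inj_on_subset by blast
    have "T (\<Sum>v\<in>R. (\<lambda>x. u (T v) * v x)) = (\<Sum>v\<in>R. (\<lambda>x. u (T v) * T v x))"
      using lin[OF R(3,1), of "\<lambda>v. u (T v)"] by simp
    also have "\<dots> = 0" using S(3) unfolding R(2) sum.reindex[OF injR] by (simp add: o_def)
    finally have z: "(\<Sum>v\<in>R. (\<lambda>x. u (T v) * v x)) = 0"
      using R(1) by (intro ker funs.span_sum funs.span_scale funs.span_base) auto
    obtain v where v: "v \<in> R" "w = T v" using S(4) R(2) by auto
    show "u w = 0"
      using funs.independentD[OF C(2) R(3) R(1) z v(1)] v(2) by simp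
  qed
qed

text \<open>The functionals together define an injective linear map into the functions supported on \<open>I\<close>, a space
of dimension \<open>card I\<close>.\<close>

lemma card_independent_le_separating_functionals:
  fixes \<phi> :: "'i \<Rightarrow> ('a \<Rightarrow> real) \<Rightarrow> real"
  assumes V: "funs.subspace V" and C: "C \<subseteq> V" "funs.independent C" and I: "finite I"
    and add: "\<And>i f g. i \<in> I \<Longrightarrow> f \<in> V \<Longrightarrow> g \<in> V \<Longrightarrow> \<phi> i (f + g) = \<phi> i f + \<phi> i g"
    and scale: "\<And>i f c. i \<in> I \<Longrightarrow> f \<in> V \<Longrightarrow> \<phi> i (\<lambda>x. c * f x) = c * \<phi> i f"
    and sep: "\<And>f. f \<in> V \<Longrightarrow> (\<And>i. i \<in> I \<Longrightarrow> \<phi> i f = 0) \<Longrightarrow> f = 0"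
  shows "finite C" "card C \<le> card I"
proof -
  define T where "T f = (\<lambda>i. if i \<in> I then \<phi> i f else 0)" for f
  have CV: "funs.span C \<subseteq> V" using funs.span_minimal[OF C(1) V] .
  have add': "T (f + g) = T f + T g" if "f \<in> V" "g \<in> V" for f g
    using that by (auto simp: T_def fun_eq_iff add)
  have scale': "T (\<lambda>x. c * f x) = (\<lambda>x. c * T f x)" if "f \<in> V" for f c
    using that by (auto simp: T_def fun_eq_iff scale)
  have ker': "f = 0" if "f \<in> funs.span C" "T f = 0" for f
  proof (rule sep)
    show "f \<in> V" using that CV by auto
    show "\<phi> i f = 0" if "i \<in> I" for i using fun_cong[OF \<open>T f = 0\<close>, of i] that by (simp add: T_def)
  qed
  have inj: "inj_on T C" and ind: "funs.independent (T ` C)"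
    using independent_image_of_injective[of V C T, OF V C add' scale' ker'] by blast+
  define U where "U = (\<lambda>i j. if i = j then 1 else 0 :: real) ` I"
  have "T f \<in> funs.span U" for f
  proof -
    have "T f = (\<Sum>i\<in>I. (\<lambda>j. \<phi> i f * (if i = j then 1 else 0)))"
      using I by (auto simp: T_def fun_eq_iff sum_fun_apply sum.delta if_distrib cong: if_cong)
    also have "\<dots> \<in> funs.span U"
      by (intro funs.span_sum funs.span_scale funs.span_base) (auto simp: U_def)
    finally show ?thesis .
  qed
  then have "finite (T ` C) \<and> card (T ` C) \<le> card U"
    using I by (intro funs.independent_span_bound ind) (auto simp: U_def)
  moreover have "card U \<le> card I" unfolding U_def using I by (rule card_image_le)
  ultimately have fT: "finite (T ` C)" and cT: "card (T ` C) \<le> card I" by (auto intro: order_trans)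
  show "finite C" by (rule finite_imageD[OF fT inj])
  show "card C \<le> card I" using cT card_image[OF inj] by linarith
qed

section \<open>Monomials\<close>

text \<open>Exponents off the basis are fixed to be 0, so that equal monomials have equal exponents.\<close>

definition exponents_of_degree :: "nat \<Rightarrow> ('a::euclidean_space \<Rightarrow> nat) set" where
  "exponents_of_degree k = {\<alpha>. (\<forall>b. b \<notin> Basis \<longrightarrow> \<alpha> b = 0) \<and> (\<Sum>b\<in>Basis. \<alpha> b) = k}"

definition monomial :: "('a::euclidean_space \<Rightarrow> nat) \<Rightarrow> 'a \<Rightarrow> real" where
  "monomial \<alpha> x = (\<Prod>b\<in>Basis. (x \<bullet> b) ^ \<alpha> b)"

lemma homog_poly_monomial: "\<alpha> \<in> exponents_of_degree k \<Longrightarrow> homog_poly k (monomial \<alpha>)"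
  using homog_poly_prod[OF finite_Basis homog_poly_power[OF homog_poly_coord], of "\<lambda>b. b" \<alpha>]
  by (auto simp: exponents_of_degree_def monomial_def[abs_def])

lemma finite_exponents_with_sum:
  assumes "finite S"
  shows "finite {\<alpha>. (\<forall>b. b \<notin> S \<longrightarrow> \<alpha> b = 0) \<and> (\<Sum>b\<in>S. \<alpha> b) = (l::nat)}"
proof (rule finite_subset)
  show "finite {\<alpha>. \<forall>b. (b \<in> S \<longrightarrow> \<alpha> b \<in> {..l}) \<and> (b \<notin> S \<longrightarrow> \<alpha> b = 0)}"
    using assms by (intro finite_set_of_finite_funs) auto
  show "{\<alpha>. (\<forall>b. b \<notin> S \<longrightarrow> \<alpha> b = 0) \<and> (\<Sum>b\<in>S. \<alpha> b) = (l::nat)}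
     \<subseteq> {\<alpha>. \<forall>b. (b \<in> S \<longrightarrow> \<alpha> b \<in> {..l}) \<and> (b \<notin> S \<longrightarrow> \<alpha> b = 0)}"
    using assms by (auto intro: member_le_sum)
qed

text \<open>Along an enumeration of \<open>S\<close> these functions become the lists of length \<open>card S\<close> with sum \<open>l\<close>.\<close>

lemma card_exponents_with_sum:
  assumes "finite S"
  shows "card {\<alpha>. (\<forall>b. b \<notin> S \<longrightarrow> \<alpha> b = 0) \<and> (\<Sum>b\<in>S. \<alpha> b) = (l::nat)} = (l + card S - 1) choose l"
    (is "card ?A = _")
proof -
  obtain bs where bs: "set bs = S" "distinct bs" using finite_distinct_list[OF assms] by blast
  let ?L = "{xs::nat list. length xs = card S \<and> sum_list xs = l}"
  have len: "length bs = card S" using bs distinct_card by metis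
  have sm: "sum_list (map \<alpha> bs) = (\<Sum>b\<in>S. \<alpha> b)" for \<alpha> :: "_ \<Rightarrow> nat"
    using sum_list_distinct_conv_sum_set[OF bs(2), of \<alpha>] bs(1) by simp
  have "bij_betw (\<lambda>\<alpha>. map \<alpha> bs) ?A ?L"
    unfolding bij_betw_def
  proof
    show "inj_on (\<lambda>\<alpha>. map \<alpha> bs) ?A"
    proof (intro inj_onI ext)
      fix \<alpha> \<beta> b assume "\<alpha> \<in> ?A" "\<beta> \<in> ?A" "map \<alpha> bs = map \<beta> bs"
      then show "\<alpha> b = \<beta> b" using bs(1) by (cases "b \<in> S") (auto simp: map_eq_conv)
    qed
    show "(\<lambda>\<alpha>. map \<alpha> bs) ` ?A = ?L"
    proof (intro equalityI subsetI)
      fix xs assume xs: "xs \<in> ?L"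
      define \<alpha> where "\<alpha> b = (case map_of (zip bs xs) b of None \<Rightarrow> 0 | Some v \<Rightarrow> v)" for b
      have "map \<alpha> bs = xs"
      proof (rule nth_equalityI)
        show "map \<alpha> bs ! i = xs ! i" if "i < length (map \<alpha> bs)" for i
          using that xs len map_of_zip_nth[of bs xs i] bs(2) by (simp add: \<alpha>_def)
      qed (use xs len in auto)
      moreover have "\<alpha> b = 0" if "b \<notin> S" for b
      proof -
        have "map_of (zip bs xs) b = None"
          using that bs(1) by (auto simp: map_of_eq_None_iff dest: set_zip_leftD)
        then show ?thesis by (simp add: \<alpha>_def)
      qed
      ultimately show "xs \<in> (\<lambda>\<alpha>. map \<alpha> bs) ` ?A"
        using xs sm[of \<alpha>] by (intro image_eqI[of _ _ \<alpha>]) auto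
    qed (auto simp: sm len)
  qed
  from bij_betw_same_card[OF this] show ?thesis by (simp only: card_length_sum_list)
qed

lemma finite_exponents_of_degree: "finite (exponents_of_degree k)"
  unfolding exponents_of_degree_def by (rule finite_exponents_with_sum) simp

lemma card_exponents_of_degree:
  "card (exponents_of_degree k :: ('a::euclidean_space \<Rightarrow> nat) set) = (k + DIM('a) - 1) choose k"
  unfolding exponents_of_degree_def by (rule card_exponents_with_sum) simp

lemma digit_sum_less:
  fixes c :: "nat \<Rightarrow> nat"
  assumes "\<And>i. i < n \<Longrightarrow> c i < D"
  shows "(\<Sum>i<n. c i * D ^ i) < D ^ n"
  using assms
proof (induction n)
  case (Suc n)
  have "(\<Sum>i<n. c i * D ^ i) < D ^ n" by (rule Suc.IH) (rule Suc.prems, simp)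
  then have "(\<Sum>i<Suc n. c i * D ^ i) < (1 + c n) * D ^ n" by (simp add: algebra_simps)
  also have "\<dots> \<le> D * D ^ n" using Suc.prems[of n] by (intro mult_right_mono) auto
  finally show ?case by simp
qed simp

lemma digits_unique:
  fixes a b :: "nat \<Rightarrow> nat"
  assumes "\<And>i. i < n \<Longrightarrow> a i < D" "\<And>i. i < n \<Longrightarrow> b i < D" "(\<Sum>i<n. a i * D ^ i) = (\<Sum>i<n. b i * D ^ i)"
  shows "\<forall>i<n. a i = b i"
  using assms
proof (induction n)
  case (Suc n)
  define A B where "A = (\<Sum>i<n. a i * D ^ i)" and "B = (\<Sum>i<n. b i * D ^ i)"
  have s: "A < D ^ n" "B < D ^ n"
    unfolding A_def B_def by (rule digit_sum_less; rule Suc.prems; simp)+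
  then have D: "D ^ n \<noteq> 0" by linarith
  have eq: "A + a n * D ^ n = B + b n * D ^ n" using Suc.prems(3) by (simp add: A_def B_def)
  have "(A + a n * D ^ n) mod D ^ n = A" "(B + b n * D ^ n) mod D ^ n = B"
    unfolding mod_mult_self1 using s by (simp_all only: mod_less)
  then have "A = B" using eq by metis
  then have "a n * D ^ n = b n * D ^ n" using eq by simp
  then have "a n = b n" using D by (simp only: mult_cancel2) simp
  moreover have "\<forall>i<n. a i = b i"
  proof (rule Suc.IH)
    show "(\<Sum>i<n. a i * D ^ i) = (\<Sum>i<n. b i * D ^ i)" using \<open>A = B\<close> by (simp only: A_def B_def)
  qed (rule Suc.prems, simp)+
  ultimately show ?case by (simp only: less_Suc_eq) blast
qed simp

text \<open>Kronecker's substitution: for \<open>x\<close> with coordinates \<open>s\<close> to the powers \<open>(k + 1)\<^sup>i\<close>, a monomial of degree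
\<open>k\<close> becomes a power of \<open>s\<close> whose exponent has the exponents of the monomial as digits in base \<open>k + 1\<close>.
So distinct monomials become distinct powers, and the claim is reduced to one variable.\<close>

lemma monomial_coefficients_eq_0:
  fixes c :: "('a::euclidean_space \<Rightarrow> nat) \<Rightarrow> real"
  assumes z: "\<And>x. (\<Sum>\<alpha>\<in>exponents_of_degree k. c \<alpha> * monomial \<alpha> x) = 0" and a: "\<alpha> \<in> exponents_of_degree k"
  shows "c \<alpha> = 0"
proof -
  obtain e where e: "bij_betw e {..<DIM('a)} (Basis :: 'a set)"
    using bij_betw_from_nat_into_finite[OF finite_Basis] by blast
  define \<nu> where "\<nu> \<alpha> = (\<Sum>i<DIM('a). \<alpha> (e i) * (k + 1) ^ i)" for \<alpha> :: "'a \<Rightarrow> nat"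
  have small: "\<alpha> b < k + 1" if "\<alpha> \<in> exponents_of_degree k" "b \<in> Basis" for \<alpha> :: "'a \<Rightarrow> nat" and b
    using that member_le_sum[of b Basis \<alpha>] by (auto simp: exponents_of_degree_def)
  have inj: "inj_on \<nu> (exponents_of_degree k)"
  proof (rule inj_onI)
    fix \<alpha> \<beta> :: "'a \<Rightarrow> nat" assume ab: "\<alpha> \<in> exponents_of_degree k" "\<beta> \<in> exponents_of_degree k" "\<nu> \<alpha> = \<nu> \<beta>"
    have "\<forall>i<DIM('a). \<alpha> (e i) = \<beta> (e i)"
      by (rule digits_unique[of _ _ "k + 1"])
         (use ab small e in \<open>auto simp: \<nu>_def bij_betw_def\<close>)
    moreover have "\<exists>i<DIM('a). b = e i" if "b \<in> Basis" for b
      using bij_betw_imp_surj_on[OF e] that by auto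
    ultimately have "\<alpha> b = \<beta> b" if "b \<in> Basis" for b using that by metis
    then show "\<alpha> = \<beta>" using ab(1,2) by (auto simp: exponents_of_degree_def fun_eq_iff) metis
  qed
  define P where "P = (\<Sum>\<alpha>\<in>exponents_of_degree k. monom (c \<alpha>) (\<nu> \<alpha>))"
  have "poly P s = 0" for s
  proof -
    define x where "x = (\<Sum>i<DIM('a). (s ^ ((k + 1) ^ i)) *\<^sub>R e i)"
    have xe: "x \<bullet> e j = s ^ ((k + 1) ^ j)" if "j < DIM('a)" for j
    proof -
      have "e i \<bullet> e j = (if i = j then 1 else 0)" if "i < DIM('a)" for i
      proof -
        have "e i \<in> Basis" "e j \<in> Basis"
          using bij_betwE[OF e] that \<open>j < DIM('a)\<close> by auto
        moreover have "e i = e j \<longleftrightarrow> i = j"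
          using inj_on_eq_iff[OF bij_betw_imp_inj_on[OF e], of i j] that \<open>j < DIM('a)\<close> by auto
        ultimately show ?thesis by (simp add: inner_Basis)
      qed
      then have "x \<bullet> e j = (\<Sum>i<DIM('a). s ^ ((k + 1) ^ i) * (if i = j then 1 else 0))"
        unfolding x_def inner_sum_left by (intro sum.cong) auto
      then show ?thesis using that by (simp add: sum.delta if_distrib cong: if_cong)
    qed
    have "monomial \<alpha> x = s ^ \<nu> \<alpha>" for \<alpha>
    proof -
      have "monomial \<alpha> x = (\<Prod>i<DIM('a). (x \<bullet> e i) ^ \<alpha> (e i))"
        unfolding monomial_def using prod.reindex_bij_betw[OF e, of "\<lambda>b. (x \<bullet> b) ^ \<alpha> b"] by simp
      also have "\<dots> = (\<Prod>i<DIM('a). s ^ (\<alpha> (e i) * (k + 1) ^ i))"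
        by (intro prod.cong refl) (simp add: xe power_mult[symmetric] mult.commute)
      also have "\<dots> = s ^ \<nu> \<alpha>" by (simp add: \<nu>_def power_sum)
      finally show ?thesis .
    qed
    then have "poly P s = (\<Sum>\<alpha>\<in>exponents_of_degree k. c \<alpha> * monomial \<alpha> x)"
      by (simp add: P_def poly_sum poly_monom)
    then show ?thesis using z by simp
  qed
  then have "P = 0" using poly_all_0_iff_0 by blast
  then have "0 = coeff P (\<nu> \<alpha>)" by simp
  also have "\<dots> = (\<Sum>\<beta>\<in>exponents_of_degree k. if \<beta> = \<alpha> then c \<beta> else 0)"
    unfolding P_def coeff_sum by (intro sum.cong refl) (use inj a in \<open>auto simp: inj_on_eq_iff\<close>)
  also have "\<dots> = c \<alpha>" using a by (simp only: sum.delta[OF finite_exponents_of_degree] if_True)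
  finally show ?thesis by simp
qed

lemma inj_on_monomial: "inj_on monomial (exponents_of_degree k)"
proof (rule inj_onI, rule ccontr)
  fix \<alpha> \<beta> :: "'a \<Rightarrow> nat"
  assume ab: "\<alpha> \<in> exponents_of_degree k" "\<beta> \<in> exponents_of_degree k" "monomial \<alpha> = monomial \<beta>" "\<alpha> \<noteq> \<beta>"
  define c where "c \<gamma> = (if \<gamma> = \<alpha> then 1 else 0) - (if \<gamma> = \<beta> then 1 else 0 :: real)" for \<gamma>
  have "(\<Sum>\<gamma>\<in>exponents_of_degree k. c \<gamma> * monomial \<gamma> x) = 0" for x
  proof -
    have "(\<Sum>\<gamma>\<in>exponents_of_degree k. c \<gamma> * monomial \<gamma> x)
      = (\<Sum>\<gamma>\<in>exponents_of_degree k. (if \<gamma> = \<alpha> then monomial \<gamma> x else 0) - (if \<gamma> = \<beta> then monomial \<gamma> x else 0))"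
      by (intro sum.cong) (auto simp: c_def)
    then show ?thesis using ab(1,2) fun_cong[OF ab(3), of x]
      by (simp only: sum_subtractf sum.delta[OF finite_exponents_of_degree] if_True)
  qed
  from monomial_coefficients_eq_0[OF this ab(1)] ab(4) show False by (simp add: c_def)
qed

lemma independent_monomials: "funs.independent (monomial ` exponents_of_degree k)"
proof
  assume "funs.dependent (monomial ` (exponents_of_degree k :: ('a \<Rightarrow> nat) set))"
  then obtain u v where u: "v \<in> monomial ` (exponents_of_degree k :: ('a \<Rightarrow> nat) set)" "u v \<noteq> 0"
     "(\<Sum>v\<in>monomial ` exponents_of_degree k. (\<lambda>x. u v * v x)) = 0"
    using funs.dependent_finite[OF finite_imageI[OF finite_exponents_of_degree]] by blast
  have "(\<Sum>\<alpha>\<in>exponents_of_degree k. u (monomial \<alpha>) * monomial \<alpha> x) = 0" for x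
    using fun_cong[OF u(3), of x] unfolding sum.reindex[OF inj_on_monomial] by (simp add: sum_fun_apply)
  from monomial_coefficients_eq_0[OF this] u(1,2) show False by auto
qed

lemma monomial_mult: "monomial \<alpha> x * monomial \<beta> x = monomial (\<lambda>b. \<alpha> b + \<beta> b) x"
  by (simp add: monomial_def power_add prod.distrib)

lemma homog_poly_in_span_monomials:
  "homog_poly k p \<Longrightarrow> p \<in> funs.span (monomial ` exponents_of_degree k)"
proof (induction rule: homog_poly.induct)
  case (homog_poly_const c)
  have "(\<lambda>x. c * monomial (\<lambda>_. 0) x) \<in> funs.span (monomial ` (exponents_of_degree 0 :: ('a \<Rightarrow> nat) set))"
    by (intro funs.span_scale funs.span_base) (auto simp: exponents_of_degree_def)
  moreover have "(\<lambda>x::'a. c * monomial (\<lambda>_. 0) x) = (\<lambda>x. c)" by (simp add: monomial_def)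
  ultimately show ?case by simp
next
  case (homog_poly_zero k) show ?case using funs.span_zero by (simp add: zero_fun_def)
next
  case (homog_poly_coord b)
  define \<alpha> where "\<alpha> b' = (if b' = b then 1 else 0::nat)" for b'
  have "monomial \<alpha> = (\<lambda>x. x \<bullet> b)"
    using homog_poly_coord by (simp add: monomial_def \<alpha>_def fun_eq_iff if_distrib prod.delta cong: if_cong)
  moreover have "\<alpha> \<in> exponents_of_degree 1" using homog_poly_coord by (auto simp: exponents_of_degree_def \<alpha>_def)
  ultimately show ?case by (metis funs.span_base imageI)
next
  case (homog_poly_add k p q)
  then show ?case using funs.span_add[of p _ q] by (simp add: plus_fun_def)
next
  case (homog_poly_mult j p k q)
  let ?S = "funs.span (monomial ` (exponents_of_degree (j + k) :: ('a \<Rightarrow> nat) set))"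
  have 1: "(\<lambda>x. monomial \<alpha> x * q x) \<in> ?S" if a: "\<alpha> \<in> exponents_of_degree j" for \<alpha> :: "'a \<Rightarrow> nat"
    using homog_poly_mult.IH(2)
  proof (induction rule: funs.span_induct_alt)
    case base then show ?case using funs.span_zero by (simp add: zero_fun_def)
  next
    case (step c r g)
    then obtain \<beta> where b: "\<beta> \<in> exponents_of_degree k" "r = monomial \<beta>" by auto
    have "(\<lambda>b. \<alpha> b + \<beta> b) \<in> exponents_of_degree (j + k)" using a b(1) by (auto simp: exponents_of_degree_def sum.distrib)
    then have "(\<lambda>x. c * monomial (\<lambda>b. \<alpha> b + \<beta> b) x) \<in> ?S"
      by (intro funs.span_scale funs.span_base) auto
    from funs.span_add[OF this step(2)] show ?case
      by (simp add: b(2) plus_fun_def algebra_simps monomial_mult[symmetric])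
  qed
  show ?case using homog_poly_mult.IH(1)
  proof (induction rule: funs.span_induct_alt)
    case base then show ?case using funs.span_zero by (simp add: zero_fun_def)
  next
    case (step c r g)
    then obtain \<alpha> where a: "\<alpha> \<in> exponents_of_degree j" "r = monomial \<alpha>" by auto
    from funs.span_add[OF funs.span_scale[OF 1[OF a(1)], of c] step(2)] show ?case
      by (simp add: a(2) plus_fun_def algebra_simps)
  qed
qed

lemma subspace_homog_poly: "funs.subspace {p. homog_poly k p}"
proof (rule funs.subspaceI; unfold mem_Collect_eq)
  show "homog_poly k 0" unfolding zero_fun_def by (rule homog_poly_zero)
  show "homog_poly k (p + q)" if "homog_poly k p" "homog_poly k q" for p q
    unfolding plus_fun_def using that by (rule homog_poly_add)
qed (rule homog_poly_cmult)

lemma span_monomials: "funs.span (monomial ` exponents_of_degree k) = {p. homog_poly k p}"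
proof (intro equalityI subsetI)
  have "monomial ` exponents_of_degree k \<subseteq> {p. homog_poly k p}" using homog_poly_monomial by auto
  then show "p \<in> {p. homog_poly k p}" if "p \<in> funs.span (monomial ` exponents_of_degree k)" for p
    using subsetD[OF funs.span_minimal[OF _ subspace_homog_poly] that] by simp
qed (simp add: homog_poly_in_span_monomials)

section \<open>Eigenspaces and multiplicities\<close>

lemma C2_on_lincomb:
  fixes F G :: "'a::euclidean_space \<Rightarrow> real"
  assumes U: "open U" and F: "C2_on U F" and G: "C2_on U G"
  shows "C2_on U (\<lambda>x. a * F x + b * G x)"
    "x \<in> U \<Longrightarrow> laplacian (\<lambda>x. a * F x + b * G x) x = a * laplacian F x + b * laplacian G x"
proof -
  let ?H = "\<lambda>x. a * F x + b * G x"
  have d: "((\<lambda>x. a * f x + b * g x) has_derivative (\<lambda>v. a * dir_deriv v f x + b * dir_deriv v g x)) (at x)"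
    if "f differentiable (at x)" "g differentiable (at x)" for f g :: "'a \<Rightarrow> real" and x
    by (intro has_derivative_add has_derivative_mult_right dir_deriv_works that)
  have dF: "F differentiable (at x)" "dir_deriv u F differentiable (at x)"
    and dG: "G differentiable (at x)" "dir_deriv u G differentiable (at x)" if "x \<in> U" for x u
    using F G that by (simp_all add: C2_on_def)
  have d1: "(?H has_derivative (\<lambda>v. a * dir_deriv v F x + b * dir_deriv v G x)) (at x)" if "x \<in> U" for x
    using that by (intro d dF dG)
  have d2: "(dir_deriv u ?H has_derivative (\<lambda>v. a * dir_deriv v (dir_deriv u F) x + b * dir_deriv v (dir_deriv u G) x)) (at x)"
    if "x \<in> U" for x u
    by (rule has_derivative_cong_open[OF d U that]) (use that dF dG dir_deriv_eqI[OF d1] in auto)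
  have "continuous_on U (dir_deriv v (dir_deriv u ?H))" for u v
  proof (rule continuous_on_cong[THEN iffD1, OF refl])
    show "a * dir_deriv v (dir_deriv u F) x + b * dir_deriv v (dir_deriv u G) x = dir_deriv v (dir_deriv u ?H) x"
      if "x \<in> U" for x using dir_deriv_eqI[OF d2[OF that]] by simp
    show "continuous_on U (\<lambda>x. a * dir_deriv v (dir_deriv u F) x + b * dir_deriv v (dir_deriv u G) x)"
      using F G by (intro continuous_intros) (auto simp: C2_on_def)
  qed
  then show "C2_on U ?H" unfolding C2_on_def
    using differentiableI[OF d1] differentiableI[OF d2] by blast
  show "laplacian ?H x = a * laplacian F x + b * laplacian G x" if "x \<in> U"
    unfolding laplacian_def dir_deriv_eqI[OF d2[OF that]] by (simp add: sum.distrib sum_distrib_left)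
qed

lemma homog_poly_C2_on: assumes p: "homog_poly k p" shows "C2_on U p"
  unfolding C2_on_def
  using homog_poly_dir_deriv(1)[OF p] homog_poly_dir_deriv(1)[OF homog_poly_dir_deriv(2)[OF p]]
    homog_poly_continuous[OF homog_poly_dir_deriv(2)[OF homog_poly_dir_deriv(2)[OF p]]] by simp

lemma eigenspace_lincomb:
  assumes "f \<in> eigenspace \<mu>" "g \<in> eigenspace \<mu>"
  shows "(\<lambda>x. a * f x + b * g x) \<in> eigenspace \<mu>"
proof -
  have e: "radial_ext (\<lambda>x. a * f x + b * g x) = (\<lambda>x. a * radial_ext f x + b * radial_ext g x)"
    by (simp add: radial_ext_def fun_eq_iff)
  have fg: "C2_on (- {0}) (radial_ext f)" "C2_on (- {0}) (radial_ext g)"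
    using assms by (auto simp: eigenspace_def)
  have "- sphere_laplacian (\<lambda>x. a * f x + b * g x) x = \<mu> * (a * f x + b * g x)" if "x \<in> sphere 0 1" for x
  proof -
    have "x \<in> - {0}" using that by auto
    then have "sphere_laplacian (\<lambda>x. a * f x + b * g x) x = a * sphere_laplacian f x + b * sphere_laplacian g x"
      unfolding sphere_laplacian_def e by (rule C2_on_lincomb(2)[OF open_minus_origin fg])
    moreover have "- sphere_laplacian f x = \<mu> * f x" "- sphere_laplacian g x = \<mu> * g x"
      using assms that unfolding eigenspace_def by blast+
    then have "sphere_laplacian f x = - \<mu> * f x" "sphere_laplacian g x = - \<mu> * g x" by linarith+
    ultimately show ?thesis by (simp add: algebra_simps)
  qed
  moreover have "C2_on (- {0}) (radial_ext (\<lambda>x. a * f x + b * g x))"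
    unfolding e by (rule C2_on_lincomb(1)[OF open_minus_origin fg])
  moreover have "a * f x + b * g x = 0" if "x \<notin> sphere 0 1" for x
    using assms that by (simp add: eigenspace_def)
  ultimately show ?thesis unfolding eigenspace_def by blast
qed

lemma zero_in_eigenspace: "(\<lambda>x. 0) \<in> eigenspace \<mu>"
proof -
  have "on_sphere (\<lambda>x. 0::real) = (\<lambda>x::'a. 0)" by (auto simp: on_sphere_def)
  then show ?thesis
    using C2_on_radial_ext_on_sphere[OF homog_poly_zero[where 'a='a, of 0]] sphere_laplacian_on_sphere[OF homog_poly_zero[where 'a='a, of 0]]
      homog_poly_laplacian(2)[OF homog_poly_zero[where 'a='a, of 0]]
    by (simp add: eigenspace_def)
qed

lemma subspace_eigenspace: "funs.subspace (eigenspace \<mu>)"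
proof (rule funs.subspaceI)
  show "0 \<in> eigenspace \<mu>" unfolding zero_fun_def by (rule zero_in_eigenspace)
  show "f + g \<in> eigenspace \<mu>" if "f \<in> eigenspace \<mu>" "g \<in> eigenspace \<mu>" for f g
    using eigenspace_lincomb[OF that, of 1 1] by (simp add: plus_fun_def)
  show "(\<lambda>x. c * f x) \<in> eigenspace \<mu>" if "f \<in> eigenspace \<mu>" for f c
    using eigenspace_lincomb[OF that zero_in_eigenspace, of c 0] by simp
qed

lemma eigenspace_continuous: "f \<in> eigenspace \<mu> \<Longrightarrow> continuous_on (sphere 0 1) f"
  using C2_on_continuous(3) by (auto simp: eigenspace_def)

definition sphere_eigenvalue :: "'a::euclidean_space itself \<Rightarrow> nat \<Rightarrow> real" where
  "sphere_eigenvalue _ k = real k * (real k + real DIM('a) - 2)"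

text \<open>The recursion that drives the determination of the spectrum: move the Laplacian from \<open>f\<close> to \<open>p\<close>.\<close>

lemma inner_eigenfunction_homog_poly:
  fixes f :: "'a::euclidean_space \<Rightarrow> real"
  assumes f: "f \<in> eigenspace \<mu>" and p: "homog_poly k p"
  shows "(sphere_eigenvalue TYPE('a) k - \<mu>) * sphere_inner f p = sphere_inner f (laplacian p)"
proof -
  let ?l = "sphere_eigenvalue TYPE('a) k"
  note c = eigenspace_continuous[OF f] homog_poly_continuous[OF p] homog_poly_continuous[OF homog_poly_laplacian(1)[OF p]]
  have "C2_on (- {0}) (radial_ext f)" using f by (simp add: eigenspace_def)
  from sphere_inner_laplacian_symmetric[OF this C2_on_radial_ext_on_sphere[OF p]]
  have "sphere_inner f (sphere_laplacian (on_sphere p)) = sphere_inner (sphere_laplacian f) (on_sphere p)" .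
  also have "sphere_inner (sphere_laplacian f) (on_sphere p) = sphere_inner (\<lambda>x. - \<mu> * f x) p"
  proof (rule sphere_inner_cong)
    fix x :: 'a assume "x \<in> sphere 0 1"
    then have "- sphere_laplacian f x = \<mu> * f x" using f unfolding eigenspace_def by blast
    then show "sphere_laplacian f x = - \<mu> * f x" by simp
  qed (simp add: on_sphere_def)
  also have "\<dots> = - \<mu> * sphere_inner f p" by (rule sphere_inner_mult_left)
  also have "sphere_inner f (sphere_laplacian (on_sphere p)) = sphere_inner f (\<lambda>x. laplacian p x + (- ?l) * p x)"
    by (intro sphere_inner_cong refl)
       (simp add: sphere_laplacian_on_sphere[OF p] sphere_eigenvalue_def del: mem_sphere)
  also have "\<dots> = sphere_inner f (laplacian p) + (- ?l) * sphere_inner f p"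
    by (subst sphere_inner_add_right) (intro c continuous_intros sphere_inner_mult_right arg_cong2[where f="(+)"] refl)+
  finally show ?thesis by (simp add: algebra_simps)
qed

text \<open>Only the degrees whose eigenvalue is \<open>\<mu>\<close> have to be assumed; in every
other degree \<open>k\<close> the recursion reduces the claim to degree \<open>k - 2\<close>. The bound \<open>K\<close> lets the lemma be used both for all degrees and for
the degrees below a given one.\<close>

lemma eigenfunction_orthogonal_homog_poly:
  fixes f :: "'a::euclidean_space \<Rightarrow> real"
  assumes f: "f \<in> eigenspace \<mu>"
    and res: "\<And>k p. k < K \<Longrightarrow> sphere_eigenvalue TYPE('a) k = \<mu> \<Longrightarrow> homog_poly k p \<Longrightarrow> sphere_inner f p = 0"
    and k: "k < K" and p: "homog_poly k p"
  shows "sphere_inner f p = 0"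
  using k p
proof (induction k arbitrary: p rule: less_induct)
  case (less k)
  have "sphere_inner f (laplacian p) = 0"
  proof (cases "k < 2")
    case True
    then have "laplacian p = (\<lambda>x. 0)" using homog_poly_laplacian(2)[OF less.prems(2)] by auto
    then show ?thesis by (simp add: sphere_inner_zero_right)
  next
    case False
    then show ?thesis using less.IH[OF _ _ homog_poly_laplacian(1)[OF less.prems(2)]] less.prems(1) by simp
  qed
  then have "(sphere_eigenvalue TYPE('a) k - \<mu>) * sphere_inner f p = 0"
    using inner_eigenfunction_homog_poly[OF f less.prems(2)] by simp
  then show ?case using res[OF less.prems(1) _ less.prems(2)] by auto
qed

text \<open>Replacing one factor of \<open>\<langle>f, f\<rangle>\<close> by \<open>f - g\<close> with a uniformly close polynomial \<open>g\<close> does not change the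
value, but makes it arbitrarily small.\<close>

lemma orthogonal_to_polynomials_imp_0:
  fixes f :: "'a::euclidean_space \<Rightarrow> real"
  assumes c: "continuous_on (sphere 0 1) f"
    and orth: "\<And>k p. homog_poly k p \<Longrightarrow> sphere_inner f p = 0"
    and x: "x \<in> sphere 0 1"
  shows "f x = 0"
proof (rule sphere_inner_self_eq_0[OF c _ x])
  have cp: "sum_of_homog_polys p \<Longrightarrow> continuous_on (sphere 0 1) p \<and> sphere_inner f p = 0" for p
  proof (induction rule: sum_of_homog_polys.induct)
    case (base k p) then show ?case using orth homog_poly_continuous by blast
  next
    case (add p q) then show ?case using sphere_inner_add_right[OF c, of p q] by (simp add: continuous_on_add)
  qed
  define I where "I = (\<integral>x. annular_weight x * \<bar>f (sgn x)\<bar> \<partial>(lborel :: 'a measure))"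
  have intI: "integrable lborel (\<lambda>x::'a. annular_weight x * \<bar>f (sgn x)\<bar>)"
    by (intro integrable_annular_weight_mult continuous_intros continuous_on_comp_sgn c)
  have I0: "I \<ge> 0" unfolding I_def by (intro Bochner_Integration.integral_nonneg) (simp add: annular_weight_nonneg)
  have le: "sphere_inner f f \<le> e * I" if "e > 0" for e
  proof -
    obtain g where g: "real_polynomial_function g" "\<And>x. x \<in> sphere 0 1 \<Longrightarrow> \<bar>f x - g x\<bar> < e"
      using Stone_Weierstrass_real_polynomial_function[OF compact_sphere c \<open>e > 0\<close>] by metis
    have gc: "continuous_on (sphere 0 1) g" "sphere_inner f g = 0"
      using cp[OF real_polynomial_function_sum_of_homog_polys[OF g(1)]] by auto
    have cd: "continuous_on (sphere 0 1) (\<lambda>x. f x + (-1) * g x)" by (intro continuous_intros c gc)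
    have "sphere_inner f f = sphere_inner f (\<lambda>x. f x + (-1) * g x)"
      using sphere_inner_add_right[OF c c, of "\<lambda>x. (-1) * g x"] gc sphere_inner_mult_right[of f "-1" g]
      by (simp add: continuous_on_minus)
    also have "\<dots> \<le> (\<integral>x. e * (annular_weight x * \<bar>f (sgn x)\<bar>) \<partial>(lborel :: 'a measure))"
      unfolding sphere_inner_def
    proof (rule integral_mono)
      show "integrable lborel (\<lambda>x. annular_weight x * (f (sgn x) * (f (sgn x) + - 1 * g (sgn x))))"
        by (rule sphere_inner_integrable[OF c cd])
      show "integrable lborel (\<lambda>x::'a. e * (annular_weight x * \<bar>f (sgn x)\<bar>))" using intI by simp
      fix x :: 'a
      show "annular_weight x * (f (sgn x) * (f (sgn x) + - 1 * g (sgn x))) \<le> e * (annular_weight x * \<bar>f (sgn x)\<bar>)"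
      proof (cases "x = 0")
        case True then show ?thesis by (simp add: annular_weight_eq_0)
      next
        case False
        then have "\<bar>f (sgn x) - g (sgn x)\<bar> \<le> e" using g(2)[of "sgn x"] by (simp add: norm_sgn)
        then have "\<bar>f (sgn x)\<bar> * \<bar>f (sgn x) - g (sgn x)\<bar> \<le> \<bar>f (sgn x)\<bar> * e" by (intro mult_left_mono) auto
        then have "f (sgn x) * (f (sgn x) + - 1 * g (sgn x)) \<le> e * \<bar>f (sgn x)\<bar>"
          using abs_ge_self[of "f (sgn x) * (f (sgn x) - g (sgn x))"] by (simp add: abs_mult mult.commute)
        from mult_left_mono[OF this annular_weight_nonneg[of x]] show ?thesis by (simp add: mult_ac)
      qed
    qed
    also have "\<dots> = e * I" by (simp add: I_def)
    finally show ?thesis .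
  qed
  have "sphere_inner f f \<le> 0"
  proof (rule field_le_epsilon)
    fix e :: real assume "e > 0"
    have "e / (I + 1) * I \<le> e * 1" using \<open>e > 0\<close> I0 by (simp add: field_simps)
    then show "sphere_inner f f \<le> 0 + e" using le[of "e / (I + 1)"] \<open>e > 0\<close> I0 by simp
  qed
  moreover have "sphere_inner f f \<ge> 0"
    unfolding sphere_inner_def by (intro Bochner_Integration.integral_nonneg) (simp add: annular_weight_nonneg)
  ultimately show "sphere_inner f f = 0" by simp
qed

lemma eigenfunction_eq_0I:
  fixes f :: "'a::euclidean_space \<Rightarrow> real"
  assumes f: "f \<in> eigenspace \<mu>"
    and res: "\<And>k p. sphere_eigenvalue TYPE('a) k = \<mu> \<Longrightarrow> homog_poly k p \<Longrightarrow> sphere_inner f p = 0"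
  shows "f = 0"
proof
  fix x
  have "sphere_inner f p = 0" if "homog_poly k p" for k p
    by (rule eigenfunction_orthogonal_homog_poly[OF f res _ that, of "Suc k"]) auto
  then have "f x = 0" if "x \<in> sphere 0 1"
    using orthogonal_to_polynomials_imp_0[OF eigenspace_continuous[OF f] _ that] by blast
  then show "f x = 0 x" using f by (cases "x \<in> sphere 0 1") (auto simp: eigenspace_def)
qed

theorem multiplicity_not_eigenvalue:
  assumes "\<And>k. sphere_eigenvalue TYPE('a::euclidean_space) k \<noteq> \<mu>"
  shows "multiplicity_of TYPE('a) \<mu> = 0"
proof -
  have "(eigenspace \<mu> :: ('a \<Rightarrow> real) set) \<subseteq> funs.span {}"
    using eigenfunction_eq_0I[of _ \<mu>] assms by auto
  from funs.dim_le_card[OF this] show ?thesis unfolding multiplicity_of_def by simp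
qed

lemma sphere_eigenvalue_strict_mono:
  assumes "DIM('a::euclidean_space) \<ge> 2" "j < k"
  shows "sphere_eigenvalue TYPE('a) j < sphere_eigenvalue TYPE('a) k"
  unfolding sphere_eigenvalue_def using assms
  by (intro mult_strict_mono') auto

text \<open>The monomials that represent polynomials of degree \<open>k\<close> on the sphere modulo lower degree, after
\<open>(x \<bullet> b)\<^sup>2\<close> has been replaced by 1 minus the other squares.\<close>

definition reduced_exps :: "'a \<Rightarrow> nat \<Rightarrow> ('a::euclidean_space \<Rightarrow> nat) set" where
  "reduced_exps b k = {\<alpha> \<in> exponents_of_degree k. \<alpha> b < 2}"

text \<open>The other exponents of degree \<open>k\<close> are those of degree \<open>k - 2\<close> raised by 2 at \<open>b\<close>.\<close>

lemma card_reduced_exps: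
  assumes b: "(b::'a::euclidean_space) \<in> Basis"
  shows "card (reduced_exps b k) + (if k < 2 then 0 else card (exponents_of_degree (k - 2) :: ('a \<Rightarrow> nat) set))
      = card (exponents_of_degree k :: ('a \<Rightarrow> nat) set)"
proof -
  define J where "J = {\<alpha> \<in> exponents_of_degree k. \<alpha> b \<ge> 2}"
  have "exponents_of_degree k = reduced_exps b k \<union> J" "reduced_exps b k \<inter> J = {}"
    by (auto simp: reduced_exps_def J_def)
  then have c: "card (exponents_of_degree k :: ('a \<Rightarrow> nat) set) = card (reduced_exps b k) + card J"
    using finite_exponents_of_degree[of k] by (metis card_Un_disjoint finite_Un)
  have upd: "sum (\<alpha>(b := n)) Basis + \<alpha> b = sum \<alpha> Basis + n" for \<alpha> :: "'a \<Rightarrow> nat" and n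
    using b by (simp add: sum.remove[OF finite_Basis b])
  have "card J = (if k < 2 then 0 else card (exponents_of_degree (k - 2) :: ('a \<Rightarrow> nat) set))"
  proof (cases "k < 2")
    case True
    have "\<alpha> b \<le> k" if "\<alpha> \<in> exponents_of_degree k" for \<alpha>
      using that member_le_sum[OF b, of \<alpha>] by (auto simp: exponents_of_degree_def)
    then have "J = {}" using True by (force simp: J_def)
    then show ?thesis using True by simp
  next
    case False
    have "bij_betw (\<lambda>\<alpha>. \<alpha>(b := \<alpha> b + 2)) (exponents_of_degree (k - 2)) J"
    proof (rule bij_betwI[where g="\<lambda>\<alpha>. \<alpha>(b := \<alpha> b - 2)"])
      show "(\<lambda>\<alpha>. \<alpha>(b := \<alpha> b + 2)) \<in> exponents_of_degree (k - 2) \<rightarrow> J"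
      proof
        fix \<alpha> :: "'a \<Rightarrow> nat" assume "\<alpha> \<in> exponents_of_degree (k - 2)"
        then show "\<alpha>(b := \<alpha> b + 2) \<in> J" using upd[of \<alpha> "\<alpha> b + 2"] False b by (auto simp: J_def exponents_of_degree_def)
      qed
      show "(\<lambda>\<alpha>. \<alpha>(b := \<alpha> b - 2)) \<in> J \<rightarrow> exponents_of_degree (k - 2)"
      proof
        fix \<alpha> :: "'a \<Rightarrow> nat" assume "\<alpha> \<in> J"
        then show "\<alpha>(b := \<alpha> b - 2) \<in> exponents_of_degree (k - 2)" using upd[of \<alpha> "\<alpha> b - 2"] b by (auto simp: J_def exponents_of_degree_def)
      qed
    qed (auto simp: J_def fun_eq_iff)
    then show ?thesis using False by (simp add: bij_betw_same_card)
  qed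
  then show ?thesis using c by simp
qed

lemma harmonic_in_eigenspace:
  fixes p :: "'a::euclidean_space \<Rightarrow> real"
  assumes p: "homog_poly k p" and h: "laplacian p = 0"
  shows "on_sphere p \<in> eigenspace (sphere_eigenvalue TYPE('a) k)"
  using C2_on_radial_ext_on_sphere[OF p] sphere_laplacian_on_sphere[OF p] h
  by (auto simp: eigenspace_def on_sphere_def sphere_eigenvalue_def)

text \<open>By induction on the exponent at \<open>b\<close>: replacing \<open>(x \<bullet> b)\<^sup>2\<close> on the sphere by 1 minus the sum of the other
squares leaves a monomial of degree \<open>k - 2\<close> and monomials of degree \<open>k\<close> with a smaller exponent
at \<open>b\<close>.\<close>

lemma inner_monomial_determined:
  fixes f :: "'a::euclidean_space \<Rightarrow> real"
  assumes c: "continuous_on (sphere 0 1) f" and b: "b \<in> Basis"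
    and low: "\<And>j p. j < k \<Longrightarrow> homog_poly j p \<Longrightarrow> sphere_inner f p = 0"
    and red: "\<And>\<alpha>. \<alpha> \<in> reduced_exps b k \<Longrightarrow> sphere_inner f (monomial \<alpha>) = 0"
    and p: "homog_poly k p"
  shows "sphere_inner f p = 0"
proof -
  have mon: "sphere_inner f (monomial \<alpha>) = 0" if "\<alpha> \<in> exponents_of_degree k" "\<alpha> b = m" for \<alpha> m
    using that
  proof (induction m arbitrary: \<alpha> rule: less_induct)
    case (less m)
    show ?case
    proof (cases "m < 2")
      case True then show ?thesis using less.prems by (intro red) (simp add: reduced_exps_def)
    next
      case False
      define \<beta> where "\<beta> = \<alpha>(b := m - 2)"
      have upd: "sum (\<gamma>(c := n)) Basis + \<gamma> c = sum \<gamma> Basis + n" if "c \<in> Basis" for \<gamma> :: "'a \<Rightarrow> nat" and c n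
        using that by (simp add: sum.remove[OF finite_Basis that])
      have k: "k \<ge> 2" and be: "\<beta> \<in> exponents_of_degree (k - 2)"
        using upd[OF b, of \<alpha> "m - 2"] False less.prems b by (auto simp: exponents_of_degree_def \<beta>_def)
      have be2: "\<beta>(c := \<beta> c + 2) \<in> exponents_of_degree k" if "c \<in> Basis" for c
        using upd[OF that, of \<beta> "\<beta> c + 2"] be k that by (auto simp: exponents_of_degree_def)
      have m2: "monomial (\<beta>(c := \<beta> c + 2)) x = monomial \<beta> x * (x \<bullet> c)\<^sup>2" if "c \<in> Basis" for c x
        unfolding monomial_def prod.remove[OF finite_Basis that]
        by (simp add: power_add power2_eq_square mult_ac)
      have ab: "\<alpha> = \<beta>(b := \<beta> b + 2)" using False less.prems(2) by (simp add: \<beta>_def fun_eq_iff)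
      let ?R = "Basis - {b} :: 'a set"
      have "monomial \<alpha> x = monomial \<beta> x + (\<Sum>c\<in>?R. (-1) * monomial (\<beta>(c := \<beta> c + 2)) x)"
        if "x \<in> sphere 0 1" for x
      proof -
        have "1 = (\<Sum>c\<in>Basis. (x \<bullet> c)\<^sup>2)"
          using that euclidean_inner[of x x] by (simp add: dot_square_norm power2_eq_square)
        also have "\<dots> = (x \<bullet> b)\<^sup>2 + (\<Sum>c\<in>?R. (x \<bullet> c)\<^sup>2)" by (rule sum.remove[OF finite_Basis b])
        finally have e: "(x \<bullet> b)\<^sup>2 = 1 - (\<Sum>c\<in>?R. (x \<bullet> c)\<^sup>2)" by simp
        have "monomial \<alpha> x = monomial \<beta> x * (x \<bullet> b)\<^sup>2" unfolding ab by (rule m2[OF b])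
        also have "\<dots> = monomial \<beta> x - (\<Sum>c\<in>?R. monomial \<beta> x * (x \<bullet> c)\<^sup>2)"
          unfolding e by (simp add: right_diff_distrib sum_distrib_left)
        also have "(\<Sum>c\<in>?R. monomial \<beta> x * (x \<bullet> c)\<^sup>2) = (\<Sum>c\<in>?R. monomial (\<beta>(c := \<beta> c + 2)) x)"
          by (intro sum.cong refl m2[symmetric]) auto
        finally show ?thesis by (simp add: sum_negf)
      qed
      then have "sphere_inner f (monomial \<alpha>)
         = sphere_inner f (\<lambda>x. monomial \<beta> x + (\<Sum>c\<in>?R. (-1) * monomial (\<beta>(c := \<beta> c + 2)) x))"
        by (intro sphere_inner_cong refl)
      also have "\<dots> = sphere_inner f (monomial \<beta>)
         + (\<Sum>c\<in>?R. (-1) * sphere_inner f (monomial (\<beta>(c := \<beta> c + 2))))"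
      proof -
        have c1: "continuous_on (sphere 0 1) (monomial \<beta>)" by (rule homog_poly_continuous[OF homog_poly_monomial[OF be]])
        have c2: "continuous_on (sphere 0 1) (\<lambda>x. (-1) * monomial (\<beta>(c := \<beta> c + 2)) x)" if "c \<in> ?R" for c
          using that by (intro continuous_intros homog_poly_continuous[OF homog_poly_monomial[OF be2]]) auto
        have c3: "continuous_on (sphere 0 1) (\<lambda>x. \<Sum>c\<in>?R. (-1) * monomial (\<beta>(c := \<beta> c + 2)) x)"
          by (rule continuous_on_sum[OF c2])
        show ?thesis
          using sphere_inner_add_right[OF c c1 c3] sphere_inner_sum_right[OF c c2, of ?R "\<lambda>c. c"]
          by (simp only: sphere_inner_mult_right)
      qed
      also have "sphere_inner f (monomial \<beta>) = 0" using k by (intro low[OF _ homog_poly_monomial[OF be]]) simp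
      also have "(\<Sum>c\<in>?R. (-1) * sphere_inner f (monomial (\<beta>(c := \<beta> c + 2)))) = 0"
      proof (intro sum.neutral ballI)
        fix c assume c: "c \<in> ?R"
        have "sphere_inner f (monomial (\<beta>(c := \<beta> c + 2))) = 0"
          by (rule less.IH[OF _ be2]) (use c False in \<open>auto simp: \<beta>_def\<close>)
        then show "(-1) * sphere_inner f (monomial (\<beta>(c := \<beta> c + 2))) = 0" by simp
      qed
      finally show ?thesis by simp
    qed
  qed
  have "p \<in> funs.span (monomial ` exponents_of_degree k)" by (rule homog_poly_in_span_monomials[OF p])
  then have "continuous_on (sphere 0 1) p \<and> sphere_inner f p = 0"
  proof (induction rule: funs.span_induct_alt)
    case base then show ?case by (simp add: sphere_inner_zero_right zero_fun_def)
  next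
    case (step r q g)
    then have q: "continuous_on (sphere 0 1) q" "sphere_inner f q = 0"
      using mon homog_poly_continuous[OF homog_poly_monomial] by auto
    have "sphere_inner f (\<lambda>x. r * q x + g x) = r * sphere_inner f q + sphere_inner f g"
      using sphere_inner_add_right[OF c, of "\<lambda>x. r * q x" g] q step sphere_inner_mult_right[of f r q]
      by (simp add: continuous_on_mult_left)
    then show ?case using q step by (auto simp: plus_fun_def intro!: continuous_intros)
  qed
  then show ?thesis by blast
qed

lemma eigenspace_upper_bound:
  assumes n: "DIM('a::euclidean_space) \<ge> 2" and b: "(b::'a) \<in> Basis"
    and B: "B \<subseteq> (eigenspace (sphere_eigenvalue TYPE('a) k) :: ('a \<Rightarrow> real) set)" "funs.independent B"
  shows "finite B" "card B \<le> card (reduced_exps b k)"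
proof -
  let ?\<mu> = "sphere_eigenvalue TYPE('a) k" and ?\<phi> = "\<lambda>\<alpha> f. sphere_inner f (monomial \<alpha>)"
  have neq: "sphere_eigenvalue TYPE('a) j = ?\<mu> \<longleftrightarrow> j = k" for j
    using sphere_eigenvalue_strict_mono[OF n, of j k] sphere_eigenvalue_strict_mono[OF n, of k j]
    by (cases j k rule: linorder_cases) auto
  have fin: "finite (reduced_exps b k)"
    unfolding reduced_exps_def by (rule finite_subset[OF _ finite_exponents_of_degree[of k]]) auto
  have cm: "continuous_on (sphere 0 1) (monomial \<alpha>)" if "\<alpha> \<in> reduced_exps b k" for \<alpha>
    using that homog_poly_continuous[OF homog_poly_monomial] by (auto simp: reduced_exps_def)
  have add: "?\<phi> \<alpha> (f + g) = ?\<phi> \<alpha> f + ?\<phi> \<alpha> g"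
    if "\<alpha> \<in> reduced_exps b k" "f \<in> eigenspace ?\<mu>" "g \<in> eigenspace ?\<mu>" for f g :: "'a \<Rightarrow> real" and \<alpha>
    using sphere_inner_add_left[OF cm[OF that(1)] eigenspace_continuous[OF that(2)] eigenspace_continuous[OF that(3)]]
    by (simp add: plus_fun_def)
  have sep: "f = 0" if f: "f \<in> eigenspace ?\<mu>" "\<And>\<alpha>. \<alpha> \<in> reduced_exps b k \<Longrightarrow> ?\<phi> \<alpha> f = 0" for f :: "'a \<Rightarrow> real"
  proof (rule eigenfunction_eq_0I[OF f(1)])
    fix j and p :: "'a \<Rightarrow> real" assume j: "sphere_eigenvalue TYPE('a) j = ?\<mu>" "homog_poly j p"
    show "sphere_inner f p = 0"
    proof (rule inner_monomial_determined[OF eigenspace_continuous[OF f(1)] b _ f(2)])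
      show "sphere_inner f q = 0" if "i < k" "homog_poly i q" for i and q :: "'a \<Rightarrow> real"
        by (rule eigenfunction_orthogonal_homog_poly[OF f(1) _ that]) (auto simp: neq)
      show "homog_poly k p" using j by (simp add: neq)
    qed
  qed
  show "finite B" "card B \<le> card (reduced_exps b k)"
    using card_independent_le_separating_functionals[where \<phi>="?\<phi>", OF subspace_eigenspace B fin add sphere_inner_mult_left sep]
    by blast+
qed

text \<open>Passing to the sphere loses no homogeneous polynomial, so independent harmonic polynomials remain
independent as eigenfunctions.\<close>

lemma on_sphere_eq_0_imp:
  fixes p :: "'a::euclidean_space \<Rightarrow> real"
  assumes p: "homog_poly k p" and z: "on_sphere p = 0"
  shows "p = 0"
proof
  fix x :: 'a
  have *: "p u = 0" if "norm u = 1" for u using fun_cong[OF z, of u] that by (simp add: on_sphere_def)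
  show "p x = 0 x"
  proof (cases "x = 0")
    case True
    obtain u :: 'a where "norm u = 1" using vector_choose_size[of 1] by auto
    then show ?thesis using homog_poly_scale[OF p, of 0 u] * True by simp
  next
    case False
    then show ?thesis using homog_poly_scale[OF p, of "norm x" "sgn x"] *[of "sgn x"]
      by (simp add: norm_sgn sgn_div_norm)
  qed
qed

lemma homog_poly_lincomb_laplacian:
  assumes "homog_poly k p" "homog_poly k q"
  shows "laplacian (\<lambda>x. a * p x + b * q x) = (\<lambda>x. a * laplacian p x + b * laplacian q x)"
  using C2_on_lincomb(2)[OF open_UNIV homog_poly_C2_on[OF assms(1)] homog_poly_C2_on[OF assms(2)]] by auto

lemma span_disjoint_independent:
  assumes ind: "funs.independent (A \<union> B)" and fin: "finite A" "finite B" and AB: "A \<inter> B = {}"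
    and f: "f \<in> funs.span A" "f \<in> funs.span B"
  shows "f = 0"
proof -
  obtain u where u: "f = (\<Sum>v\<in>A. (\<lambda>x. u v * v x))" using f(1) unfolding funs.span_finite[OF fin(1)] by auto
  obtain w where w: "f = (\<Sum>v\<in>B. (\<lambda>x. w v * v x))" using f(2) unfolding funs.span_finite[OF fin(2)] by auto
  define c where "c v = (if v \<in> A then u v else - w v)" for v
  have "(\<Sum>v\<in>A \<union> B. (\<lambda>x. c v * v x)) = (\<Sum>v\<in>A. (\<lambda>x. c v * v x)) + (\<Sum>v\<in>B. (\<lambda>x. c v * v x))"
    by (rule sum.union_disjoint[OF fin AB])
  also have "(\<Sum>v\<in>A. (\<lambda>x. c v * v x)) = f" unfolding u by (intro sum.cong) (auto simp: c_def)
  also have "(\<Sum>v\<in>B. (\<lambda>x. c v * v x)) = (\<Sum>v\<in>B. (\<lambda>x. - w v * v x))"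
    using AB by (intro sum.cong refl) (auto simp: c_def)
  also have "\<dots> = - f" unfolding w by (simp add: fun_eq_iff sum_fun_apply sum_negf)
  finally have "(\<Sum>v\<in>A \<union> B. (\<lambda>x. c v * v x)) = 0" by (simp only: add.right_inverse)
  from funs.independentD[OF ind _ subset_refl this] fin have "c v = 0" if "v \<in> A" for v
    using that by simp
  then have "u v = 0" if "v \<in> A" for v using that by (simp add: c_def)
  then show "f = 0" unfolding u by (simp add: fun_eq_iff sum_fun_apply)
qed

text \<open>Dimension count for the lower bound: extend a basis \<open>BK\<close> of the harmonic polynomials of degree \<open>k\<close> to
a basis \<open>B\<close> of all homogeneous polynomials of degree \<open>k\<close>. The Laplacian is injective on the span of
\<open>B - BK\<close>, so this set is no larger than the dimension in degree \<open>k - 2\<close>. For \<open>k < 2\<close> all polynomials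
are harmonic, and \<open>B - BK\<close> is empty.\<close>

theorem multiplicity_eigenvalue:
  assumes n: "DIM('a::euclidean_space) \<ge> 2" and b: "(b::'a) \<in> Basis"
  shows "multiplicity_of TYPE('a) (sphere_eigenvalue TYPE('a) k) = card (reduced_exps b k)"
proof -
  let ?E = "eigenspace (sphere_eigenvalue TYPE('a) k) :: ('a \<Rightarrow> real) set"
  let ?P = "{p. homog_poly k p} :: ('a \<Rightarrow> real) set"
  let ?K = "{p. homog_poly k p \<and> laplacian p = 0} :: ('a \<Rightarrow> real) set"
  obtain BK where BK: "BK \<subseteq> ?K" "funs.independent BK" "?K \<subseteq> funs.span BK"
    using funs.maximal_independent_subset_extend[of "{}" ?K] funs.independent_empty by auto
  have "BK \<subseteq> ?P" using BK(1) by auto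
  then obtain B where B: "BK \<subseteq> B" "B \<subseteq> ?P" "funs.independent B" "?P \<subseteq> funs.span B"
    using funs.maximal_independent_subset_extend[OF _ BK(2), of ?P] by metis
  have cM: "card (monomial ` (exponents_of_degree k :: ('a \<Rightarrow> nat) set)) = card (exponents_of_degree k :: ('a \<Rightarrow> nat) set)"
    by (rule card_image[OF inj_on_monomial])
  have "funs.dim ?P = card (monomial ` (exponents_of_degree k :: ('a \<Rightarrow> nat) set))"
    using funs.dim_span_eq_card_independent[OF independent_monomials] by (simp add: span_monomials)
  then have cB: "card B = card (exponents_of_degree k :: ('a \<Rightarrow> nat) set)"
    using funs.basis_card_eq_dim[OF B(2,4,3)] cM by simp
  have fB: "finite B"
    using funs.independent_span_bound[OF finite_imageI[OF finite_exponents_of_degree] B(3), of monomial k] B(2) span_monomials by blast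
  let ?C = "B - BK"
  have addL: "laplacian (p + q) = laplacian p + laplacian q" if "p \<in> ?P" "q \<in> ?P" for p q
    using homog_poly_lincomb_laplacian[of k p q 1 1] that by (simp add: plus_fun_def)
  have scaleL: "laplacian (\<lambda>x. c * p x) = (\<lambda>x. c * laplacian p x)" if "p \<in> ?P" for p c
    using homog_poly_lincomb_laplacian[of k p p c 0] that by simp
  have PC: "funs.span ?C \<subseteq> ?P" using B(2) by (intro funs.span_minimal subspace_homog_poly) auto
  have BC: "B = ?C \<union> BK" using B(1) by auto
  have fBK: "finite BK" using fB B(1) finite_subset by blast
  have disj: "f = 0" if "f \<in> funs.span ?C" "f \<in> funs.span BK" for f
    by (rule span_disjoint_independent[OF _ _ fBK _ that]) (use B(3) BC fB in auto)
  have kerL: "f = 0" if "f \<in> funs.span ?C" "laplacian f = 0" for f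
    using that PC BK(3) by (intro disj) auto
  have cC: "card ?C \<le> (if k < 2 then 0 else card (exponents_of_degree (k - 2) :: ('a \<Rightarrow> nat) set))"
  proof (cases "k < 2")
    case True
    have "v \<notin> ?C" for v
    proof
      assume v: "v \<in> ?C"
      then have "homog_poly k v" using B(2) by auto
      then have "laplacian v = 0" using homog_poly_laplacian(2) True by (auto simp: fun_eq_iff)
      then have "v = 0" using kerL[OF funs.span_base[OF v]] by simp
      then show False using v B(3) funs.dependent_zero by auto
    qed
    then have "?C = {}" by auto
    then have "card ?C = 0" by (simp only: card.empty)
    then show ?thesis by (simp only: le0)
  next
    case False
    have C: "?C \<subseteq> ?P" "funs.independent ?C" using B(2) funs.independent_mono[OF B(3), of ?C] by auto
    have inj: "inj_on laplacian ?C" and ind: "funs.independent (laplacian ` ?C)"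
      using independent_image_of_injective[OF subspace_homog_poly C addL scaleL kerL] by blast+
    have "laplacian ` ?C \<subseteq> funs.span (monomial ` exponents_of_degree (k - 2))"
      using C(1) homog_poly_laplacian(1) by (auto simp: span_monomials)
    then have "card (laplacian ` ?C) \<le> card (monomial ` (exponents_of_degree (k - 2) :: ('a \<Rightarrow> nat) set))"
      using funs.independent_span_bound[OF finite_imageI[OF finite_exponents_of_degree] ind] by blast
    also have "\<dots> = card (exponents_of_degree (k - 2) :: ('a \<Rightarrow> nat) set)" by (rule card_image[OF inj_on_monomial])
    finally show ?thesis using False by (simp add: card_image[OF inj])
  qed
  have "card ?C + card BK = card B"
    using B(1) fB fBK by (simp add: card_Diff_subset card_mono)
  then have cBK: "card (reduced_exps b k) \<le> card BK" using cC cB card_reduced_exps[OF b, of k] by linarith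
  have addS: "on_sphere (p + q) = on_sphere p + on_sphere q"
    and scaleS: "on_sphere (\<lambda>x. c * p x) = (\<lambda>x. c * on_sphere p x)" for p q :: "'a \<Rightarrow> real" and c
    by (auto simp: on_sphere_def fun_eq_iff)
  have BKP: "funs.span BK \<subseteq> ?P" using \<open>BK \<subseteq> ?P\<close> by (intro funs.span_minimal subspace_homog_poly)
  have kerS: "f = 0" if "f \<in> funs.span BK" "on_sphere f = 0" for f
    using that BKP on_sphere_eq_0_imp by blast
  have injS: "inj_on on_sphere BK" and indS: "funs.independent (on_sphere ` BK)"
    using independent_image_of_injective[OF subspace_homog_poly \<open>BK \<subseteq> ?P\<close> BK(2) addS scaleS kerS] by blast+
  have "on_sphere ` BK \<subseteq> ?E" using BK(1) harmonic_in_eigenspace by blast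
  then obtain BE where BE: "on_sphere ` BK \<subseteq> BE" "BE \<subseteq> ?E" "funs.independent BE" "?E \<subseteq> funs.span BE"
    using funs.maximal_independent_subset_extend[OF _ indS] by metis
  have up: "finite BE" "card BE \<le> card (reduced_exps b k)"
    using eigenspace_upper_bound[OF n b BE(2,3)] by auto
  have "card BK \<le> card BE" using card_mono[OF up(1) BE(1)] by (simp add: card_image[OF injS])
  then have "card BE = card (reduced_exps b k)" using up(2) cBK by simp
  then show ?thesis
    unfolding multiplicity_of_def using funs.basis_card_eq_dim[OF BE(2,4,3)] by simp
qed

section \<open>The counting function and its expansion\<close>

text \<open>Stated as a sum rather than with truncated subtraction: the terms telescope (with step 2) in the sum over \<open>k\<close>.\<close>

lemma multiplicity_sphere_eigenvalue:
  assumes n: "DIM('a::euclidean_space) = Suc d" "d \<ge> 1"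
  shows "multiplicity_of TYPE('a) (sphere_eigenvalue TYPE('a) k)
     + (if k < 2 then 0 else (k - 2 + d) choose d) = (k + d) choose d"
proof -
  obtain b :: 'a where b: "b \<in> Basis" using nonempty_Basis by blast
  have c: "card (exponents_of_degree j :: ('a \<Rightarrow> nat) set) = (j + d) choose d" for j
    using binomial_symmetric[of j "j + d"] by (simp add: card_exponents_of_degree n(1))
  show ?thesis
    using multiplicity_eigenvalue[OF _ b, of k] card_reduced_exps[OF b, of k, unfolded c] n by simp
qed

lemma sum_multiplicities:
  assumes n: "DIM('a::euclidean_space) = Suc d" "d \<ge> 1"
  shows "(\<Sum>k\<le>L. multiplicity_of TYPE('a) (sphere_eigenvalue TYPE('a) k))
     = ((L + d) choose d) + (if L = 0 then 0 else (L - 1 + d) choose d)"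
proof (induction L)
  case 0 then show ?case using multiplicity_sphere_eigenvalue[OF n, of 0] by simp
next
  case (Suc L)
  then show ?case using multiplicity_sphere_eigenvalue[OF n, of "Suc L"] by (cases L) auto
qed

lemma eigenvalue_count_eq:
  assumes n: "DIM('a::euclidean_space) = Suc d" "d \<ge> 1" and w: "w \<ge> 0" "w * (w + real d - 1) = z"
  shows "eigenvalue_count TYPE('a) z
    = ((nat \<lfloor>w\<rfloor> + d) choose d) + (if nat \<lfloor>w\<rfloor> = 0 then 0 else (nat \<lfloor>w\<rfloor> - 1 + d) choose d)"
proof -
  let ?ev = "sphere_eigenvalue TYPE('a)" and ?m = "multiplicity_of TYPE('a)"
  define L where "L = nat \<lfloor>w\<rfloor>"
  have ev: "?ev k = real k * (real k + real d - 1)" for k by (simp add: sphere_eigenvalue_def n(1))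
  have mono: "?ev j < ?ev k" if "j < k" for j k using sphere_eigenvalue_strict_mono[OF _ that, where 'a='a] n by simp
  have inj: "inj_on ?ev A" for A
    by (rule inj_onI) (metis mono linorder_neqE_nat less_irrefl)
  have le: "?ev k \<le> z \<longleftrightarrow> k \<le> L" for k
  proof -
    have "real k * (real k + real d - 1) \<le> w * (w + real d - 1) \<longleftrightarrow> real k \<le> w"
    proof
      assume "real k \<le> w"
      then show "real k * (real k + real d - 1) \<le> w * (w + real d - 1)" using n(2) by (intro mult_mono) auto
    next
      assume *: "real k * (real k + real d - 1) \<le> w * (w + real d - 1)"
      show "real k \<le> w"
      proof (rule ccontr)
        assume "\<not> real k \<le> w"
        then have "w * (w + real d - 1) < real k * (real k + real d - 1)"
          using w(1) n(2) by (intro mult_strict_mono') auto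
        then show False using * by simp
      qed
    qed
    then show ?thesis using w by (simp add: ev L_def le_nat_iff le_floor_iff nat_le_iff of_nat_le_iff)
  qed
  have "{(\<mu>, j). \<mu> \<le> z \<and> j < ?m \<mu>} = (SIGMA \<mu>:?ev ` {..L}. {..<?m \<mu>})"
  proof (intro equalityI subsetI)
    fix p assume "p \<in> {(\<mu>, j). \<mu> \<le> z \<and> j < ?m \<mu>}"
    then obtain \<mu> j where p: "p = (\<mu>, j)" "\<mu> \<le> z" "j < ?m \<mu>" by auto
    then obtain k where "\<mu> = ?ev k" using multiplicity_not_eigenvalue[where 'a='a, of \<mu>] by fastforce
    then show "p \<in> (SIGMA \<mu>:?ev ` {..L}. {..<?m \<mu>})" using p le by auto
  qed (auto simp: le)
  then have "eigenvalue_count TYPE('a) z = (\<Sum>\<mu>\<in>?ev ` {..L}. ?m \<mu>)"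
    by (simp add: eigenvalue_count_def)
  also have "\<dots> = (\<Sum>k\<le>L. ?m (?ev k))" by (simp add: sum.reindex[OF inj])
  finally show ?thesis unfolding sum_multiplicities[OF n] L_def .
qed

text \<open>Both binomial coefficients contain the factors \<open>L + 1, \<dots>, L + d - 1\<close>; the remaining factors
\<open>L + d\<close> and \<open>L\<close> add up to \<open>2 (L + d/2)\<close>.\<close>

lemma binomial_sum_eq_prod:
  assumes d: "d \<ge> 1"
  shows "real (((L + d) choose d) + (if L = 0 then 0 else (L - 1 + d) choose d))
    = 2 / fact d * (real L + real d / 2) * (\<Prod>j=1..<d. real L + real j)"
proof -
  have p: "real ((m + d) choose d) = (\<Prod>j=1..d. real m + real j) / fact d" for m
  proof -
    have "real ((m + d) choose d) = pochhammer (real m + 1) d / fact d"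
      using gbinomial_pochhammer'[of "real (m + d)" d] by (simp add: binomial_gbinomial)
    also have "pochhammer (real m + 1) d = (\<Prod>j=1..d. real m + real j)"
      unfolding pochhammer_prod by (rule prod.reindex_bij_witness[of _ "\<lambda>j. j - 1" Suc]) auto
    finally show ?thesis .
  qed
  have split1: "{1..d} = insert d {1..<d}" using d by auto
  have A: "(\<Prod>j=1..d. real L + real j) = (real L + real d) * (\<Prod>j=1..<d. real L + real j)"
    unfolding split1 by (subst prod.insert) auto
  have B: "real (if L = 0 then 0 else (L - 1 + d) choose d) = real L * (\<Prod>j=1..<d. real L + real j) / fact d"
  proof (cases L)
    case (Suc m)
    have "(\<Prod>j=1..d. real m + real j) = (\<Prod>j=0..<d. real L + real j)"
      by (rule prod.reindex_bij_witness[of _ Suc "\<lambda>j. j - 1"]) (auto simp: Suc)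
    also have "{0..<d} = insert 0 {1..<d}" using d by auto
    also have "(\<Prod>j\<in>insert 0 {1..<d}. real L + real j) = real L * (\<Prod>j=1..<d. real L + real j)"
      by (subst prod.insert) auto
    finally show ?thesis using p[of m] Suc by simp
  qed simp
  show ?thesis unfolding of_nat_add B p A by (simp add: field_simps)
qed


lemma sphere_volume_eq: "sphere_volume TYPE('a::euclidean_space) = real DIM('a) * unit_ball_vol (real DIM('a))"
proof -
  have "{t *\<^sub>R x | t x. 0 \<le> t \<and> t \<le> 1 \<and> x \<in> sphere (0::'a) 1} = cball 0 1"
  proof (intro equalityI subsetI)
    fix y :: 'a assume "y \<in> cball 0 1"
    obtain u :: 'a where "norm u = 1" using vector_choose_size[of 1] by auto
    then have "y = norm y *\<^sub>R (if y = 0 then u else sgn y)" "norm (if y = 0 then u else sgn y) = 1"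
      by (auto simp: sgn_div_norm)
    then show "y \<in> {t *\<^sub>R x | t x. 0 \<le> t \<and> t \<le> 1 \<and> x \<in> sphere (0::'a) 1}"
      using \<open>y \<in> cball 0 1\<close>
      by (intro CollectI exI[of _ "norm y"] exI[of _ "if y = 0 then u else sgn y"] conjI) auto
  qed auto
  then show ?thesis unfolding sphere_volume_def sphere_measure_def
    using content_cball[of 1 "0::'a"] by simp
qed

text \<open>Legendre's duplication formula at half-integers, by the functional equation: raising \<open>n\<close> by 1 exchanges
the two factors and shifts one of them by 1.\<close>

lemma Gamma_half_duplication:
  "Gamma (1 + real n / 2) * Gamma (1 / 2 + real n / 2) = fact n * sqrt pi / 2 ^ n"
proof (induction n)
  case 0 show ?case by (simp add: Gamma_one_half_real)
next
  case (Suc n)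
  have "Gamma (1 / 2 + real n / 2 + 1) = (1 / 2 + real n / 2) * Gamma (1 / 2 + real n / 2)"
    by (rule Gamma_plus1) (auto elim!: nonpos_Ints_cases)
  moreover have e: "1 + real (Suc n) / 2 = 1 / 2 + real n / 2 + 1" "1 / 2 + real (Suc n) / 2 = 1 + real n / 2"
    by (simp_all add: field_simps)
  ultimately have "Gamma (1 + real (Suc n) / 2) * Gamma (1 / 2 + real (Suc n) / 2)
      = (1 / 2 + real n / 2) * (Gamma (1 + real n / 2) * Gamma (1 / 2 + real n / 2))"
    unfolding e by (simp only: mult_ac)
  then show ?case unfolding Suc.IH by (simp add: field_simps)
qed

text \<open>The Weyl constant of the \<open>d\<close>-sphere; in the duplication formula the powers of \<open>\<pi>\<close> and 2 cancel.\<close>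

lemma L_class_times_volume:
  assumes n: "DIM('a::euclidean_space) = Suc d"
  shows "L_class 0 d * sphere_volume TYPE('a) = 2 / fact d"
proof -
  let ?h = "1 / 2 + real d / 2"
  have g: "Gamma (?h + 1) = ?h * Gamma ?h"
    by (rule Gamma_plus1) (auto elim!: nonpos_Ints_cases)
  have "(4 * pi) powr (- (real d / 2)) = inverse (2 ^ d * pi powr (real d / 2))"
  proof -
    have "(4::real) powr (real d / 2) = (2 powr 2) powr (real d / 2)" by simp
    also have "\<dots> = 2 ^ d" unfolding powr_powr by (simp add: powr_realpow)
    finally show ?thesis by (simp add: powr_minus powr_mult)
  qed
  moreover have "pi powr (real (Suc d) / 2) = sqrt pi * pi powr (real d / 2)"
    by (simp add: powr_add[symmetric] powr_half_sqrt[symmetric] add_divide_distrib)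
  moreover have "real (Suc d) / 2 + 1 = ?h + 1" "real (Suc d) = 2 * ?h" by (simp_all add: field_simps)
  ultimately have "L_class 0 d * sphere_volume TYPE('a)
      = inverse (2 ^ d * pi powr (real d / 2)) / Gamma (1 + real d / 2) * (2 * ?h * (sqrt pi * pi powr (real d / 2) / (?h * Gamma ?h)))"
    unfolding L_class_def sphere_volume_eq n unit_ball_vol_def using g by simp
  also have "\<dots> = 2 * sqrt pi / (2 ^ d * (Gamma (1 + real d / 2) * Gamma ?h))"
  proof -
    have cancel: "inverse (P * A) / G * (2 * h * (s * A / (h * H))) = 2 * s / (P * (G * H))"
      if "A \<noteq> 0" "h \<noteq> 0" for A h P G H s :: real
    proof -
      have "inverse A * A = 1" "h * inverse h = 1" using that by simp_all
      then show ?thesis unfolding divide_inverse inverse_mult_distrib by algebra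
    qed
    show ?thesis by (rule cancel) (auto simp: add_nonneg_eq_0_iff)
  qed
  also have "\<dots> = 2 / fact d" unfolding Gamma_half_duplication by simp
  finally show ?thesis .
qed

text \<open>The coefficient of \<open>y\<^sup>2\<close> in the product collects the \<open>b\<close> of each factor and the second elementary
symmetric function of the \<open>a j\<close>, written by power sums. The \<open>a j\<close> may vary with \<open>z\<close>, since the
fluctuation \<open>psi (w z)\<close> does not converge.\<close>

lemma prod_second_order_expansion:
  fixes y :: "real \<Rightarrow> real" and f a :: "'i \<Rightarrow> real \<Rightarrow> real"
  assumes fin: "finite J" and y: "(y \<longlongrightarrow> 0) at_top"
    and bnd: "\<And>j. j \<in> J \<Longrightarrow> a j \<in> O[at_top](\<lambda>_. 1)"
    and f: "\<And>j. j \<in> J \<Longrightarrow> (\<lambda>z. f j z - (1 + a j z * y z + b * y z ^ 2)) \<in> O[at_top](\<lambda>z. y z ^ 3)"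
  shows "(\<lambda>z. (\<Prod>j\<in>J. f j z) - (1 + (\<Sum>j\<in>J. a j z) * y z
      + (real (card J) * b + ((\<Sum>j\<in>J. a j z)\<^sup>2 - (\<Sum>j\<in>J. (a j z)\<^sup>2)) / 2) * y z ^ 2)) \<in> O[at_top](\<lambda>z. y z ^ 3)"
  using fin bnd f
proof (induction J rule: finite_induct)
  case empty then show ?case by simp
next
  case (insert i J)
  define s where "s z = (\<Sum>j\<in>J. a j z)" for z
  define e where "e z = real (card J) * b + ((\<Sum>j\<in>J. a j z)\<^sup>2 - (\<Sum>j\<in>J. (a j z)\<^sup>2)) / 2" for z
  define R where "R z = (\<Prod>j\<in>J. f j z) - (1 + s z * y z + e z * y z ^ 2)" for z
  define Q where "Q z = f i z - (1 + a i z * y z + b * y z ^ 2)" for z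
  have y1: "y \<in> O[at_top](\<lambda>_. 1)" using y by (intro bigoI_tendsto[of _ _ 0]) auto
  have s1: "s \<in> O[at_top](\<lambda>_. 1)" unfolding s_def[abs_def] using insert.prems(1) by (intro big_sum_in_bigo) auto
  have a1: "a j \<in> O[at_top](\<lambda>_. 1)" if "j \<in> insert i J" for j using insert.prems(1) that by auto
  have m1: "(\<lambda>z. g z * h z) \<in> O[at_top](\<lambda>_. 1)" if "g \<in> O[at_top](\<lambda>_. 1)" "h \<in> O[at_top](\<lambda>_. 1)" for g h :: "real \<Rightarrow> real"
    using landau_o.big.mult[OF that] by simp
  have e1: "e \<in> O[at_top](\<lambda>_. 1)" unfolding e_def[abs_def] power2_eq_square
  proof -
    have "(\<lambda>z. (\<Sum>j\<in>J. a j z) * (\<Sum>j\<in>J. a j z)) \<in> O[at_top](\<lambda>_. 1)"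
      using m1[OF s1 s1] by (simp only: s_def)
    moreover have "(\<lambda>z. \<Sum>j\<in>J. a j z * a j z) \<in> O[at_top](\<lambda>_. 1)"
      using a1 by (intro big_sum_in_bigo m1) auto
    ultimately have "(\<lambda>z. (1 / 2) * ((\<Sum>j\<in>J. a j z) * (\<Sum>j\<in>J. a j z) - (\<Sum>j\<in>J. a j z * a j z))) \<in> O[at_top](\<lambda>_. 1)"
      by (intro m1[OF _ sum_in_bigo(2)]) auto
    then show "(\<lambda>z. real (card J) * b + ((\<Sum>j\<in>J. a j z) * (\<Sum>j\<in>J. a j z) - (\<Sum>j\<in>J. a j z * a j z)) / 2) \<in> O[at_top](\<lambda>_. 1)"
      by (intro sum_in_bigo(1)) auto
  qed
  have R: "R \<in> O[at_top](\<lambda>z. y z ^ 3)"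
    using insert.IH insert.prems by (simp add: R_def[abs_def] s_def e_def)
  have Q: "Q \<in> O[at_top](\<lambda>z. y z ^ 3)" using insert.prems(2)[of i] by (simp add: Q_def[abs_def])
  have m3: "(\<lambda>z. g z * h z) \<in> O[at_top](\<lambda>z. y z ^ 3)" if "g \<in> O[at_top](\<lambda>_. 1)" "h \<in> O[at_top](\<lambda>z. y z ^ 3)" for g h :: "real \<Rightarrow> real"
    using landau_o.big.mult[OF that] by simp
  have fi1: "f i \<in> O[at_top](\<lambda>_. 1)"
  proof -
    have y3: "(\<lambda>z. y z ^ 3) \<in> O[at_top](\<lambda>_. 1)" using m1[OF y1 m1[OF y1 y1]] by (simp add: power3_eq_cube mult.assoc)
    have "(\<lambda>z. 1 + a i z * y z + b * (y z * y z) + Q z) \<in> O[at_top](\<lambda>_. 1)"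
      using landau_o.big.trans[OF Q y3] a1[of i] y1 by (intro sum_in_bigo m1) auto
    then show ?thesis by (simp add: Q_def power2_eq_square)
  qed
  have P1: "(\<lambda>z. 1 + s z * y z + e z * (y z * y z)) \<in> O[at_top](\<lambda>_. 1)"
    using s1 e1 y1 by (intro sum_in_bigo m1) auto
  define W where "W z = a i z * e z + b * s z + b * e z * y z" for z
  have W: "W \<in> O[at_top](\<lambda>_. 1)" unfolding W_def[abs_def] using a1[of i] e1 s1 y1 by (intro sum_in_bigo m1) auto
  have "(\<lambda>z. f i z * R z + (1 + s z * y z + e z * (y z * y z)) * Q z + W z * y z ^ 3) \<in> O[at_top](\<lambda>z. y z ^ 3)"
    by (intro sum_in_bigo m3 fi1 P1 R Q W) auto
  moreover have "(\<Prod>j\<in>insert i J. f j z) - (1 + (\<Sum>j\<in>insert i J. a j z) * y z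
      + (real (card (insert i J)) * b + ((\<Sum>j\<in>insert i J. a j z)\<^sup>2 - (\<Sum>j\<in>insert i J. (a j z)\<^sup>2)) / 2) * y z ^ 2)
    = f i z * R z + (1 + s z * y z + e z * (y z * y z)) * Q z + W z * y z ^ 3" for z
  proof -
    have 1: "(\<Prod>j\<in>insert i J. f j z) = f i z * (R z + (1 + s z * y z + e z * y z ^ 2))"
      using insert.hyps by (simp add: R_def)
    have 2: "(\<Sum>j\<in>insert i J. a j z) = a i z + s z" using insert.hyps by (simp add: s_def)
    have 3: "real (card (insert i J)) * b + ((\<Sum>j\<in>insert i J. a j z)\<^sup>2 - (\<Sum>j\<in>insert i J. (a j z)\<^sup>2)) / 2
       = b + e z + a i z * s z"
      unfolding 2 using insert.hyps by (simp add: e_def s_def power2_eq_square field_simps)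
    have 4: "f i z = Q z + (1 + a i z * y z + b * y z ^ 2)" by (simp add: Q_def)
    show ?thesis unfolding 1 3 unfolding 2
      by (simp add: 4 W_def power2_eq_square power3_eq_cube algebra_simps)
  qed
  ultimately show ?case by presburger
qed


lemma sqrt_1_plus_bound:
  assumes "t \<ge> 0" shows "\<bar>sqrt (1 + t) - (1 + t / 2)\<bar> \<le> t\<^sup>2 / 4"
proof -
  define r where "r = sqrt (1 + t)"
  have r: "r \<ge> 1" "r * r = 1 + t" using assms by (auto simp: r_def)
  have t: "t = r * r - 1" using r by simp
  have "(r - 1) * (r - 1) * 1 \<le> (r - 1) * (r - 1) * ((r + 1) * (r + 1) / 2)"
  proof (rule mult_left_mono)
    have "2 * 2 \<le> (r + 1) * (r + 1)" using r by (intro mult_mono) auto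
    then show "1 \<le> (r + 1) * (r + 1) / 2" by simp
  qed simp
  moreover have "r - (1 + t / 2) = - ((r - 1) * (r - 1) / 2)" unfolding t by (simp add: field_simps)
  moreover have "(r - 1) * (r - 1) * ((r + 1) * (r + 1) / 2) = t\<^sup>2 / 2" unfolding t by (simp add: field_simps power2_eq_square)
  ultimately show ?thesis unfolding r_def[symmetric] by simp
qed

text \<open>With \<open>m = d - 1\<close> and \<open>h = d/2\<close> the first sum is 0.\<close>

lemma sum_shifted_powers:
  "(\<Sum>j=1..m. real j - h) = real m * (real m + 1) / 2 - real m * h"
  "(\<Sum>j=1..m. (real j - h)\<^sup>2) = real m * (real m + 1) * (2 * real m + 1) / 6 - h * real m * (real m + 1) + real m * h\<^sup>2"
  by (induction m) (simp_all add: field_simps power2_eq_square)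

theorem theorem4p1p5:
  fixes d :: nat and w :: "real \<Rightarrow> real"
  assumes "d \<ge> 2" and "CARD('n::finite) = d"
    and "\<And>z. z \<ge> 0 \<Longrightarrow> w z \<ge> 0 \<and> w z * (w z + real d - 1) = z"
  shows "(\<lambda>z. real (eigenvalue_count TYPE((real ^ 'n) \<times> real) z)
              / (L_class 0 d * sphere_volume TYPE((real ^ 'n) \<times> real) * z powr (real d / 2))
            - (1 - L_class 0 (d - 1) / L_class 0 d
                     * (sphere_volume TYPE(real ^ 'n) / sphere_volume TYPE((real ^ 'n) \<times> real))
                     * psi (w z) * z powr (- 1 / 2)
                 + real d * (real d - 1) * (12 * (psi (w z))\<^sup>2 + 2 * real d - 1) / 24
                     * z powr (- 1)))
         \<in> O[at_top](\<lambda>z. z powr (- 3 / 2))"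
proof -
  have dim: "DIM((real ^ 'n) \<times> real) = Suc d" "DIM(real ^ 'n) = Suc (d - 1)" using assms(1,2) by simp_all
  have d: "d \<ge> 1" using assms(1) by simp
  have weyl: "L_class 0 d * sphere_volume TYPE((real ^ 'n) \<times> real) = 2 / fact d"
    "L_class 0 (d - 1) * sphere_volume TYPE(real ^ 'n) = 2 / fact (d - 1)"
    by (rule L_class_times_volume[OF dim(1)], rule L_class_times_volume[OF dim(2)])
  have ratio: "L_class 0 (d - 1) / L_class 0 d
      * (sphere_volume TYPE(real ^ 'n) / sphere_volume TYPE((real ^ 'n) \<times> real)) = real d"
    unfolding times_divide_times_eq weyl using d by (simp add: fact_reduce)
  define y where "y z = z powr (- 1 / 2)" for z :: real
  \<comment> \<open>Measured from the centre \<open>L + d/2\<close>, the factors \<open>L + j\<close> have the shifts \<open>j - d/2\<close>; index 0 is the factor \<open>L + d/2\<close> itself.\<close>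
  define c where "c j = (if j = 0 then 0 else real j - real d / 2)" for j :: nat
  define a where "a j z = c j - psi (w z)" for j :: nat and z
  \<comment> \<open>\<open>u\<^sup>2 = z + 2 b\<close> for \<open>u = w z + (d - 1)/2\<close>, so \<open>u / sqrt z = 1 + b / z + O(1 / z\<^sup>2)\<close>.\<close>
  define b where "b = (real d - 1)\<^sup>2 / 8"
  define f where "f j z = (w z + (real d - 1) / 2 + a j z) * y z" for j :: nat and z
  have y0: "(y \<longlongrightarrow> 0) at_top" unfolding y_def by (rule tendsto_neg_powr) (auto intro: filterlim_ident)
  have psi: "\<bar>psi t\<bar> \<le> 1" for t unfolding psi_def by linarith
  have a1: "a j \<in> O[at_top](\<lambda>_. 1)" for j
  proof (rule bigoI[of _ "\<bar>c j\<bar> + 1"], rule always_eventually, rule allI)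
    show "norm (a j z) \<le> (\<bar>c j\<bar> + 1) * norm (1::real)" for z
      using psi[of "w z"] unfolding a_def by simp
  qed
  have f3: "(\<lambda>z. f j z - (1 + a j z * y z + b * y z ^ 2)) \<in> O[at_top](\<lambda>z. y z ^ 3)" for j
  proof (rule bigoI[of _ "b\<^sup>2"])
    show "\<forall>\<^sub>F z in at_top. norm (f j z - (1 + a j z * y z + b * y z ^ 2)) \<le> b\<^sup>2 * norm (y z ^ 3)"
      using eventually_ge_at_top[of 1]
    proof eventually_elim
      case (elim z)
      have wz: "w z \<ge> 0" "w z * (w z + real d - 1) = z" using assms(3)[of z] elim by auto
      have y: "y z > 0" "y z \<le> 1" using elim powr_mono[of "- 1 / 2" 0 z] by (auto simp: y_def)
      have "y z ^ 2 = z powr (- 1)" unfolding y_def power2_eq_square powr_add[symmetric] by simp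
      then have yz: "y z ^ 2 * z = 1" using elim by (simp add: powr_minus)
      let ?u = "w z + (real d - 1) / 2"
      have "?u * ?u = z + 2 * b" using wz(2) by (simp add: b_def power2_eq_square field_simps)
      then have "(?u * y z)\<^sup>2 = (z + 2 * b) * y z ^ 2" unfolding power_mult_distrib power2_eq_square by simp
      then have "(?u * y z)\<^sup>2 = y z ^ 2 * z + 2 * b * y z ^ 2"
        by (simp only: distrib_right mult.commute[of z])
      then have "(?u * y z)\<^sup>2 = 1 + 2 * b * y z ^ 2" unfolding yz .
      moreover have "?u * y z \<ge> 0" using wz(1) d y by simp
      ultimately have e: "?u * y z = sqrt (1 + 2 * b * y z ^ 2)" by (metis real_sqrt_unique)
      have "f j z - (1 + a j z * y z + b * y z ^ 2) = sqrt (1 + 2 * b * y z ^ 2) - (1 + 2 * b * y z ^ 2 / 2)"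
        unfolding e[symmetric] by (simp add: f_def algebra_simps)
      moreover have "2 * b * y z ^ 2 \<ge> 0" by (simp add: b_def)
      ultimately have "norm (f j z - (1 + a j z * y z + b * y z ^ 2)) \<le> (2 * b * y z ^ 2)\<^sup>2 / 4"
        using sqrt_1_plus_bound[of "2 * b * y z ^ 2"] by (simp only: real_norm_def)
      also have "\<dots> = b\<^sup>2 * (y z ^ 3 * y z)" by (simp add: power2_eq_square power3_eq_cube)
      also have "\<dots> \<le> b\<^sup>2 * (y z ^ 3 * 1)" using y by (intro mult_left_mono) auto
      also have "\<dots> = b\<^sup>2 * norm (y z ^ 3)" using y by simp
      finally show ?case .
    qed
  qed
  have split: "{..<d} = insert 0 {1..d - 1}" using d by auto
  have d1: "real (d - 1) = real d - 1" using d by simp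
  have sc: "(\<Sum>j<d. c j) = 0"
  proof -
    have "(\<Sum>j<d. c j) = (\<Sum>j=1..d - 1. real j - real d / 2)"
      unfolding split by (subst sum.insert) (auto simp: c_def intro!: sum.cong)
    then show ?thesis unfolding sum_shifted_powers d1 by (simp add: field_simps)
  qed
  have sc2: "(\<Sum>j<d. (c j)\<^sup>2) = real d * (real d - 1) * (real d - 2) / 12"
  proof -
    have "(\<Sum>j<d. (c j)\<^sup>2) = (\<Sum>j=1..d - 1. (real j - real d / 2)\<^sup>2)"
      unfolding split by (subst sum.insert) (auto simp: c_def intro!: sum.cong)
    then show ?thesis unfolding sum_shifted_powers d1 by (simp add: field_simps power2_eq_square)
  qed
  have sa: "(\<Sum>j<d. a j z) = - real d * psi (w z)" for z
    by (simp add: a_def sum_subtractf sc)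
  have sa2: "(\<Sum>j<d. (a j z)\<^sup>2) = real d * (real d - 1) * (real d - 2) / 12 + real d * (psi (w z))\<^sup>2" for z
  proof -
    have "(\<Sum>j<d. (a j z)\<^sup>2) = (\<Sum>j<d. (c j)\<^sup>2) - 2 * psi (w z) * (\<Sum>j<d. c j) + real d * (psi (w z))\<^sup>2"
      by (simp add: a_def power2_diff sum.distrib sum_subtractf sum_distrib_left mult_ac)
    then show ?thesis unfolding sc sc2 by simp
  qed
  have coef: "real (card {..<d}) * b + ((\<Sum>j<d. a j z)\<^sup>2 - (\<Sum>j<d. (a j z)\<^sup>2)) / 2
     = real d * (real d - 1) * (12 * (psi (w z))\<^sup>2 + 2 * real d - 1) / 24" for z
    unfolding sa sa2 b_def by (simp add: field_simps power2_eq_square)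
  have main: "(\<lambda>z. (\<Prod>j<d. f j z) - (1 + (- real d * psi (w z)) * y z
      + real d * (real d - 1) * (12 * (psi (w z))\<^sup>2 + 2 * real d - 1) / 24 * y z ^ 2)) \<in> O[at_top](\<lambda>z. y z ^ 3)"
    using prod_second_order_expansion[of "{..<d}" y a f b, OF finite_lessThan y0 a1 f3] unfolding coef unfolding sa .
  have ev: "\<forall>\<^sub>F z in at_top.
     real (eigenvalue_count TYPE((real ^ 'n) \<times> real) z)
              / (L_class 0 d * sphere_volume TYPE((real ^ 'n) \<times> real) * z powr (real d / 2))
            - (1 - L_class 0 (d - 1) / L_class 0 d
                     * (sphere_volume TYPE(real ^ 'n) / sphere_volume TYPE((real ^ 'n) \<times> real))
                     * psi (w z) * z powr (- 1 / 2)
                 + real d * (real d - 1) * (12 * (psi (w z))\<^sup>2 + 2 * real d - 1) / 24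
                     * z powr (- 1))
     = (\<Prod>j<d. f j z) - (1 + (- real d * psi (w z)) * y z
      + real d * (real d - 1) * (12 * (psi (w z))\<^sup>2 + 2 * real d - 1) / 24 * y z ^ 2)"
    using eventually_ge_at_top[of 1]
  proof eventually_elim
    case (elim z)
    have wz: "w z \<ge> 0" "w z * (w z + real d - 1) = z" using assms(3)[of z] elim by auto
    define L where "L = nat \<lfloor>w z\<rfloor>"
    have L: "real L = w z - psi (w z) - 1 / 2" using wz(1) by (simp add: L_def psi_def)
    have fj: "(\<Prod>j<d. f j z) = (real L + real d / 2) * (\<Prod>j=1..<d. real L + real j) * y z ^ d"
    proof -
      have "(\<Prod>j<d. f j z) = (\<Prod>j<d. w z + (real d - 1) / 2 + a j z) * y z ^ d"
        by (simp add: f_def prod.distrib)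
      also have "(\<Prod>j<d. w z + (real d - 1) / 2 + a j z) = (\<Prod>j\<in>insert 0 {1..<d}. w z + (real d - 1) / 2 + a j z)"
        using d by (intro prod.cong) auto
      also have "\<dots> = (real L + real d / 2) * (\<Prod>j=1..<d. real L + real j)"
      proof -
        have "w z + (real d - 1) / 2 + a 0 z = real L + real d / 2"
          by (simp add: a_def c_def L diff_divide_distrib)
        moreover have "(\<Prod>j=1..<d. w z + (real d - 1) / 2 + a j z) = (\<Prod>j=1..<d. real L + real j)"
          by (intro prod.cong refl) (simp add: a_def c_def L diff_divide_distrib)
        ultimately show ?thesis by simp
      qed
      finally show ?thesis .
    qed
    have count: "real (eigenvalue_count TYPE((real ^ 'n) \<times> real) z)
        = 2 / fact d * (real L + real d / 2) * (\<Prod>j=1..<d. real L + real j)"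
      unfolding eigenvalue_count_eq[OF dim(1) d wz] L_def[symmetric] by (rule binomial_sum_eq_prod[OF d])
    have yd: "y z ^ d = inverse (z powr (real d / 2))"
    proof -
      have "y z ^ d = z powr (- (real d / 2))" using elim by (simp add: y_def powr_power)
      then show ?thesis by (simp only: powr_minus)
    qed
    have cancel: "2 / F * X * P / (2 / F * Z) = X * P * inverse Z" if "F \<noteq> 0" for F X P Z :: real
      using that by (cases "Z = 0") (auto simp: field_simps)
    have "real (eigenvalue_count TYPE((real ^ 'n) \<times> real) z)
              / (L_class 0 d * sphere_volume TYPE((real ^ 'n) \<times> real) * z powr (real d / 2)) = (\<Prod>j<d. f j z)"
      unfolding fj weyl count yd by (rule cancel) simp
    moreover have "z powr (- 1) = y z ^ 2" unfolding y_def power2_eq_square powr_add[symmetric] by simp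
    moreover have "z powr (- 1 / 2) = y z" by (simp only: y_def)
    ultimately show ?case unfolding ratio by (simp only: mult_minus_left minus_mult_left[symmetric] add_uminus_conv_diff)
  qed
  have y3: "\<forall>\<^sub>F z in at_top. y z ^ 3 = z powr (- 3 / 2)"
    using eventually_ge_at_top[of 1] by eventually_elim (simp add: y_def powr_power)
  show ?thesis
    by (rule landau_o.big.in_cong[THEN iffD2, OF ev]) (use main landau_o.big.cong[OF y3] in simp)
qed

end
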